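(* Let $(U_1,U_2,A)$ be strip-admissible with values in $U(2)$ and $GL(2,\mathbb C)$, admitting a dominated splitting with line fields $\ell_s,\ell_u$. Then there is $\delta>0$ such that the line field $\ell_s$ extends to a holomorphic map $\tilde\ell\colon\Omega_\delta^\circ\to\mathbb{CP}^1$ with $$\tilde\ell(w+e_j)=U_j(w)\tilde\ell(w)\quad(j=1,2),\qquad A^{(\mathcal N)}(w)^{-1}\tilde\ell(S^{\mathcal N}w)=\tilde\ell(w),\qquad \tilde\ell|_{\mathbb R^2}=\ell_s,$$ for a suitable block length $\mathcal N\ge1$ (in particular, $U_j(w)$ and $A^{(\mathcal N)}(w)$ are invertible on $\Omega_\delta^\circ$).
   Context: Notation. $w=(w_1,w_2)$, $e_1=(1,0)$, $e_2=(0,1)$, $\tau\in\mathbb R^2$, $Sw=w+\tau$ (acting on $\mathbb C^2$ as well). $\mathbb{CP}^1$ is the space of lines in $\mathbb C^2$; invertible matrices act on it projectively. For $\delta>0$, $\Omega_\delta=\{w\in\mathbb C^2:|\operatorname{Im}w_1|\le\delta,|\operatorname{Im}w_2|\le\delta\}$ with interior $\Omega_\delta^\circ$. $A^{(N)}(w)=A(S^{N-1}w)\cdots A(w)$. Sewing system and cocycle. A continuous unitary sewing system is a pair of continuous $U_1,U_2\colon\mathbb R^2\to U(2)$ with (K1) $U_1(w+e_2)U_2(w)=U_2(w+e_1)U_1(w)$. A continuous equivariant cocycle is a continuous $A\colon\mathbb R^2\to GL(2,\mathbb C)$ with (K2) $A(w+e_j)U_j(w)=U_j(Sw)A(w)$,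 $j=1,2$. An invariant line is a continuous $\ell\colon\mathbb R^2\to\mathbb{CP}^1$ with $\ell(w+e_j)=U_j(w)\ell(w)$ and $A(w)\ell(w)=\ell(Sw)$. Strip-admissible. For some $\delta_0>0$ the maps $U_1,U_2,A$ extend to matrix functions (denoted by the same letters) holomorphic on an open neighborhood of $\Omega_{\delta_0}$ and bounded on $\Omega_{\delta_0}$, with $U_j(w)$ unitary and $\det A(w)\ne0$ for real $w$, and (K1), (K2) holding on $\mathbb R^2$. Dominated splitting. A pair of invariant lines $\ell_s,\ell_u$ with $\ell_s(w)\ne\ell_u(w)$ for all $w$, such that for some integer $N\ge1$ and $0<\kappa_0<1$, $\|A^{(N)}(z)|_{\ell_s(z)}\|/\mathfrak m(A^{(N)}(z)|_{\ell_u(z)})\le\kappa_0^2$ for all $z\in\mathbb R^2$, where $\mathfrak m(M)=\min_{|v|=1}|Mv|$. *)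

theory Defs
  imports "HOL-Analysis.Analysis"
begin

typedef cp1 = "{L :: (complex^2) set. vec.subspace L \<and> vec.dim L = 1}"
proof -
  have "vec.dim (vec.span {axis 1 1 :: complex^2}) = 1"
    by (subst vec.dim_span, subst vec.dim_eq_card_independent) (auto simp: axis_eq_0_iff)
  then show ?thesis
    using vec.subspace_span by blast
qed

definition line_through :: "complex^2 \<Rightarrow> cp1"
  where "line_through v = Abs_cp1 (vec.span {v})"

text \<open>The topology is the quotient topology of \<open>v \<mapsto> line_through v\<close> on the open set
  of nonzero vectors.\<close>

instantiation cp1 :: topological_space
begin

definition open_cp1 :: "cp1 set \<Rightarrow> bool"
  where "open_cp1 W \<longleftrightarrow> open {v. v \<noteq> 0 \<and> line_through v \<in> W}"

instance
proof
  show "open (UNIV :: cp1 set)"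
    by (simp add: open_cp1_def open_Collect_neq)
next
  fix V W :: "cp1 set"
  assume "open V" "open W"
  then have "open ({v. v \<noteq> 0 \<and> line_through v \<in> V} \<inter> {v. v \<noteq> 0 \<and> line_through v \<in> W})"
    unfolding open_cp1_def by (rule open_Int)
  then show "open (V \<inter> W)"
    unfolding open_cp1_def by (rule back_subst[where P = "open"]) auto
next
  fix K :: "cp1 set set"
  assume "\<forall>W\<in>K. open W"
  then have "open (\<Union>W\<in>K. {v. v \<noteq> 0 \<and> line_through v \<in> W})"
    unfolding open_cp1_def by blast
  then show "open (\<Union>K)"
    unfolding open_cp1_def by (rule back_subst[where P = "open"]) auto
qed

end

text \<open>The projective action. It is only meaningful for invertible \<open>M\<close>; otherwise the image
  of a line need not be a line and the value is unspecified.\<close>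

definition proj_act :: "complex^2^2 \<Rightarrow> cp1 \<Rightarrow> cp1"
  where "proj_act M L = Abs_cp1 ((\<lambda>v. M *v v) ` Rep_cp1 L)"

definition chart_domain :: "2 \<Rightarrow> cp1 set"
  where "chart_domain i = {L. \<exists>v\<in>Rep_cp1 L. v $ i \<noteq> 0}"

text \<open>For \<open>L \<in> chart_domain i\<close> this is the unique vector of \<open>L\<close> whose \<open>i\<close>-th coordinate is 1;
  its other coordinate is the standard affine coordinate of \<open>L\<close>.\<close>

definition chart_rep :: "2 \<Rightarrow> cp1 \<Rightarrow> complex^2"
  where "chart_rep i L = (THE v. v \<in> Rep_cp1 L \<and> v $ i = 1)"

text \<open>Frechet differentiability with a complex-linear derivative; used for open \<open>S\<close> only.\<close>

definition holomorphic2_on :: "(complex^2 \<Rightarrow> complex) \<Rightarrow> (complex^2) set \<Rightarrow> bool"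
  where "holomorphic2_on f S \<longleftrightarrow>
    (\<forall>w\<in>S. \<exists>D. (f has_derivative D) (at w within S) \<and> (\<forall>c v. D (c *s v) = c * D v))"

definition matrix_holomorphic_on :: "(complex^2 \<Rightarrow> complex^2^2) \<Rightarrow> (complex^2) set \<Rightarrow> bool"
  where "matrix_holomorphic_on F S \<longleftrightarrow> (\<forall>i k. holomorphic2_on (\<lambda>w. F w $ i $ k) S)"

text \<open>Holomorphy in the two affine charts (for \<open>k = i\<close> the coordinate is constantly 1).
  By continuity the preimages of the chart domains are open.\<close>

definition cp1_holomorphic_on :: "(complex^2 \<Rightarrow> cp1) \<Rightarrow> (complex^2) set \<Rightarrow> bool"
  where "cp1_holomorphic_on f S \<longleftrightarrow> continuous_on S f \<and>
    (\<forall>i k. holomorphic2_on (\<lambda>w. chart_rep i (f w) $ k) {w\<in>S. f w \<in> chart_domain i})"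

definition complex_vec :: "real^2 \<Rightarrow> complex^2"
  where "complex_vec w = (\<chi> i. of_real (w $ i))"

definition strip :: "real \<Rightarrow> (complex^2) set"
  where "strip \<delta> = {w. \<forall>i. \<bar>Im (w $ i)\<bar> \<le> \<delta>}"

definition unitary :: "complex^2^2 \<Rightarrow> bool"
  where "unitary M \<longleftrightarrow>
    (\<chi> i k. cnj (M $ k $ i)) ** M = mat 1 \<and> M ** (\<chi> i k. cnj (M $ k $ i)) = mat 1"

definition shift :: "'a::plus \<Rightarrow> 'a \<Rightarrow> 'a"
  where "shift t w = w + t"

fun cocycle_iterate :: "('a::plus) \<Rightarrow> ('a \<Rightarrow> complex^2^2) \<Rightarrow> nat \<Rightarrow> 'a \<Rightarrow> complex^2^2"
  where
    "cocycle_iterate t A 0 w = mat 1"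
  | "cocycle_iterate t A (Suc n) w = A ((shift t ^^ n) w) ** cocycle_iterate t A n w"

text \<open>The pair \<open>(U\<^sub>1, U\<^sub>2)\<close> is a family \<open>U\<close> indexed by the type \<open>2\<close>, with \<open>e\<^sub>j\<close> being \<open>axis j 1\<close>.\<close>

definition unitary_sewing_system :: "(2 \<Rightarrow> real^2 \<Rightarrow> complex^2^2) \<Rightarrow> bool"
  where "unitary_sewing_system U \<longleftrightarrow>
    (\<forall>j. continuous_on UNIV (U j)) \<and> (\<forall>j w. unitary (U j w)) \<and>
    (\<forall>w. U 1 (w + axis 2 1) ** U 2 w = U 2 (w + axis 1 1) ** U 1 w)"

definition equivariant_cocycle ::
    "real^2 \<Rightarrow> (2 \<Rightarrow> real^2 \<Rightarrow> complex^2^2) \<Rightarrow> (real^2 \<Rightarrow> complex^2^2) \<Rightarrow> bool"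
  where "equivariant_cocycle \<tau> U A \<longleftrightarrow>
    continuous_on UNIV A \<and> (\<forall>w. det (A w) \<noteq> 0) \<and>
    (\<forall>j w. A (w + axis j 1) ** U j w = U j (shift \<tau> w) ** A w)"

definition invariant_line ::
    "real^2 \<Rightarrow> (2 \<Rightarrow> real^2 \<Rightarrow> complex^2^2) \<Rightarrow> (real^2 \<Rightarrow> complex^2^2) \<Rightarrow> (real^2 \<Rightarrow> cp1) \<Rightarrow> bool"
  where "invariant_line \<tau> U A l \<longleftrightarrow>
    continuous_on UNIV l \<and>
    (\<forall>j w. l (w + axis j 1) = proj_act (U j w) (l w)) \<and>
    (\<forall>w. proj_act (A w) (l w) = l (shift \<tau> w))"

definition norm_on_line :: "complex^2^2 \<Rightarrow> cp1 \<Rightarrow> real"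
  where "norm_on_line M L = (SUP v\<in>{v \<in> Rep_cp1 L. norm v = 1}. norm (M *v v))"

definition conorm_on_line :: "complex^2^2 \<Rightarrow> cp1 \<Rightarrow> real"
  where "conorm_on_line M L = (INF v\<in>{v \<in> Rep_cp1 L. norm v = 1}. norm (M *v v))"

definition dominated_splitting ::
    "real^2 \<Rightarrow> (2 \<Rightarrow> real^2 \<Rightarrow> complex^2^2) \<Rightarrow> (real^2 \<Rightarrow> complex^2^2) \<Rightarrow>
      (real^2 \<Rightarrow> cp1) \<Rightarrow> (real^2 \<Rightarrow> cp1) \<Rightarrow> bool"
  where "dominated_splitting \<tau> U A ls lu \<longleftrightarrow>
    invariant_line \<tau> U A ls \<and> invariant_line \<tau> U A lu \<and> (\<forall>w. ls w \<noteq> lu w) \<and>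
    (\<exists>N\<ge>1. \<exists>\<kappa>. 0 < \<kappa> \<and> \<kappa> < 1 \<and>
      (\<forall>z. norm_on_line (cocycle_iterate \<tau> A N z) (ls z)
            / conorm_on_line (cocycle_iterate \<tau> A N z) (lu z) \<le> \<kappa>\<^sup>2))"

definition strip_extension ::
    "real \<Rightarrow> (real^2 \<Rightarrow> complex^2^2) \<Rightarrow> (complex^2 \<Rightarrow> complex^2^2) \<Rightarrow> bool"
  where "strip_extension \<delta> F F' \<longleftrightarrow>
    (\<forall>w. F' (complex_vec w) = F w) \<and>
    (\<exists>V. open V \<and> strip \<delta> \<subseteq> V \<and> matrix_holomorphic_on F' V) \<and>
    bounded (F' ` strip \<delta>)"

text \<open>Strip-admissibility of \<open>(U, A)\<close>, with the width \<open>\<delta>\<close> and the extensions \<open>U'\<close>, \<open>A'\<close> as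
  explicit witnesses. Values of \<open>U'\<close>, \<open>A'\<close> off a neighbourhood of the strip are irrelevant.\<close>

definition strip_admissible ::
    "real^2 \<Rightarrow> (2 \<Rightarrow> real^2 \<Rightarrow> complex^2^2) \<Rightarrow> (real^2 \<Rightarrow> complex^2^2) \<Rightarrow>
      real \<Rightarrow> (2 \<Rightarrow> complex^2 \<Rightarrow> complex^2^2) \<Rightarrow> (complex^2 \<Rightarrow> complex^2^2) \<Rightarrow> bool"
  where "strip_admissible \<tau> U A \<delta> U' A' \<longleftrightarrow>
    \<delta> > 0 \<and> unitary_sewing_system U \<and> equivariant_cocycle \<tau> U A \<and>
    (\<forall>j. strip_extension \<delta> (U j) (U' j)) \<and> strip_extension \<delta> A A'"

end

theory Submission
  imports Defs "HOL-Complex_Analysis.Conformal_Mappings"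
begin

text \<open>Domination makes \<open>\<ell>\<^sub>s\<close> recognisable from growth rates alone: a vector of \<open>\<ell>\<^sub>s(x)\<close> grows
  exponentially slower under the iterates of the block \<open>F = A\<^sup>(\<^sup>N\<^sup>)\<close> than some other vector, and up to
  scaling it is the only one that does (\<open>dominated_direction_unique\<close>). This description makes sense at
  every complex point where the block is invertible along the orbit, and the extension is defined
  by it. Invariance under the block is then immediate, because the description concerns the tail of
  the orbit. Equivariance under \<open>U\<^sub>j\<close> follows too: (K2) extends to the strip by the identity theorem,
  and \<open>U\<^sub>j\<close> is bounded with bounded inverse on a thin strip, so it does not affect growth
  comparisons (\<open>dominated_direction_transfer\<close>).

  It remains to see that the dominated direction exists near the real plane and is holomorphic.
  Around a real point \<open>x\<close>, take unit vectors in \<open>\<ell>\<^sub>s\<close> and \<open>\<ell>\<^sub>u\<close> along the real orbit of \<open>x\<close> as frames.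
  In them the block at \<open>x\<close> is diagonal with ratio at most \<open>\<kappa>\<^sub>0\<^sup>2 < 1\<close>, and at a complex point
  within a small distance \<open>\<rho>\<close> of \<open>x\<close> it is close to diagonal at every time, because translations preserve
  distances and \<open>F\<close>, being bounded and holomorphic, is Lipschitz on a thinner strip. The inverse
  blocks therefore act on the slopes \<open>t\<close> of lines \<open>s + t u\<close> as uniform contractions of the unit disc.
  Pulling back the slope \<open>0\<close> from time \<open>k\<close> to time \<open>0\<close> gives holomorphic functions that converge uniformly
  as \<open>k \<rightarrow> \<infinity>\<close>; the limit spans the dominated direction (\<open>invariant_slopes\<close>,
  \<open>dominated_direction_frames\<close>).

  The radius \<open>\<rho>\<close> is the same for all \<open>x\<close>, although \<open>\<real>\<^sup>2\<close> is not compact and \<open>\<ell>\<^sub>s\<close>, \<open>\<ell>\<^sub>u\<close> are not periodic.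
  The quantities on which it depends, the angle between the two lines and \<open>|det A|\<close>, are periodic
  because the sewing maps are unitary. The frames are chosen point by point, without any matching; the local
  solutions agree on overlaps because the growth description involves no frame.\<close>

section \<open>Holomorphic functions of two complex variables\<close>

lemma norm_smult_complex: "norm (c *s v) = norm c * norm (v :: complex^2)"
  by (simp add: norm_vec_def L2_set_def norm_mult power_mult_distrib real_sqrt_mult
      flip: sum_distrib_left)

lemma scaleR_eq_smult: "r *\<^sub>R v = of_real r *s (v :: complex^2)"
  unfolding vec_eq_iff vector_scaleR_component vector_smult_component by (simp add: scaleR_conv_of_real)

lemma holomorphic2_on_subset:
  assumes "holomorphic2_on f S" "T \<subseteq> S"
  shows "holomorphic2_on f T"
  using assms unfolding holomorphic2_on_def by (meson has_derivative_subset subsetD)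

lemma holomorphic2_on_cong:
  assumes "\<And>w. w \<in> S \<Longrightarrow> f w = g w"
  shows "holomorphic2_on f S \<longleftrightarrow> holomorphic2_on g S"
proof -
  have "holomorphic2_on g S" if "holomorphic2_on f S" "\<And>w. w \<in> S \<Longrightarrow> f w = g w" for f g
    using that unfolding holomorphic2_on_def by (metis has_derivative_transform)
  then show ?thesis using assms by metis
qed

lemma holomorphic2_on_locally:
  assumes "\<And>w. w \<in> S \<Longrightarrow> \<exists>T. open T \<and> w \<in> T \<and> holomorphic2_on f (S \<inter> T)"
  shows "holomorphic2_on f S"
  unfolding holomorphic2_on_def
proof
  fix w assume w: "w \<in> S"
  then obtain T where T: "open T" "w \<in> T" "holomorphic2_on f (S \<inter> T)" using assms by blast
  moreover have "at w within (S \<inter> T) = at w within S"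
    using T by (metis Int_iff at_within_nhd inf_assoc inf_left_idem inf_commute)
  moreover have "\<exists>D. (f has_derivative D) (at w within (S \<inter> T)) \<and> (\<forall>c v. D (c *s v) = c * D v)"
    using T w unfolding holomorphic2_on_def by blast
  ultimately show "\<exists>D. (f has_derivative D) (at w within S) \<and> (\<forall>c v. D (c *s v) = c * D v)"
    by simp
qed

lemma holomorphic2_on_imp_continuous_on: "holomorphic2_on f S \<Longrightarrow> continuous_on S f"
  unfolding holomorphic2_on_def continuous_on_eq_continuous_within
  by (meson has_derivative_continuous)

lemma holomorphic2_on_const [intro!]: "holomorphic2_on (\<lambda>w. c) S"
  unfolding holomorphic2_on_def by (intro ballI exI[of _ "\<lambda>_. 0"]) simp

lemma holomorphic2_on_add [intro!]:
  assumes "holomorphic2_on f S" "holomorphic2_on g S"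
  shows "holomorphic2_on (\<lambda>w. f w + g w) S"
  unfolding holomorphic2_on_def
proof
  fix w assume "w \<in> S"
  then obtain D E where "(f has_derivative D) (at w within S)" "\<forall>c v. D (c *s v) = c * D v"
    "(g has_derivative E) (at w within S)" "\<forall>c v. E (c *s v) = c * E v"
    using assms unfolding holomorphic2_on_def by metis
  then show "\<exists>D. ((\<lambda>w. f w + g w) has_derivative D) (at w within S) \<and> (\<forall>c v. D (c *s v) = c * D v)"
    by (intro exI[of _ "\<lambda>v. D v + E v"]) (auto intro!: derivative_eq_intros simp: algebra_simps)
qed

lemma holomorphic2_on_mult [intro!]:
  assumes "holomorphic2_on f S" "holomorphic2_on g S"
  shows "holomorphic2_on (\<lambda>w. f w * g w) S"
  unfolding holomorphic2_on_def
proof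
  fix w assume "w \<in> S"
  then obtain D E where "(f has_derivative D) (at w within S)" "\<forall>c v. D (c *s v) = c * D v"
    "(g has_derivative E) (at w within S)" "\<forall>c v. E (c *s v) = c * E v"
    using assms unfolding holomorphic2_on_def by metis
  then show "\<exists>D. ((\<lambda>w. f w * g w) has_derivative D) (at w within S) \<and> (\<forall>c v. D (c *s v) = c * D v)"
    by (intro exI[of _ "\<lambda>v. f w * E v + D v * g w"]) (auto intro!: derivative_eq_intros simp: algebra_simps)
qed

lemma holomorphic2_on_diff [intro!]:
  assumes "holomorphic2_on f S" "holomorphic2_on g S"
  shows "holomorphic2_on (\<lambda>w. f w - g w) S"
  using holomorphic2_on_add[OF assms(1) holomorphic2_on_mult[OF holomorphic2_on_const[of "-1"] assms(2)]]
  by simp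

lemma holomorphic2_on_divide [intro!]:
  assumes "holomorphic2_on f S" "holomorphic2_on g S" "\<And>w. w \<in> S \<Longrightarrow> g w \<noteq> 0"
  shows "holomorphic2_on (\<lambda>w. f w / g w) S"
proof -
  have "holomorphic2_on (\<lambda>w. inverse (g w)) S"
    unfolding holomorphic2_on_def
  proof
    fix w assume w: "w \<in> S"
    then obtain E where "(g has_derivative E) (at w within S)" "\<forall>c v. E (c *s v) = c * E v"
      using assms unfolding holomorphic2_on_def by metis
    then show "\<exists>D. ((\<lambda>w. inverse (g w)) has_derivative D) (at w within S) \<and> (\<forall>c v. D (c *s v) = c * D v)"
      using assms(3)[OF w]
      by (intro exI[of _ "\<lambda>v. - (inverse (g w) * E v * inverse (g w))"])
        (auto intro!: derivative_eq_intros simp: algebra_simps)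
  qed
  from holomorphic2_on_mult[OF assms(1) this] show ?thesis
    by (simp add: divide_inverse)
qed

lemma holomorphic2_on_translate:
  assumes "holomorphic2_on f T" "\<And>w. w \<in> S \<Longrightarrow> w + c \<in> T"
  shows "holomorphic2_on (\<lambda>w. f (w + c)) S"
  unfolding holomorphic2_on_def
proof
  fix w assume w: "w \<in> S"
  then obtain D where D: "(f has_derivative D) (at (w + c) within T)" "\<forall>c v. D (c *s v) = c * D v"
    using assms unfolding holomorphic2_on_def by metis
  have "((\<lambda>w. w + c) has_derivative (\<lambda>v. v)) (at w within S)"
    by (auto intro!: derivative_eq_intros)
  moreover have "(f has_derivative D) (at (w + c) within (\<lambda>w. w + c) ` S)"
    using D(1) assms(2) by (auto intro: has_derivative_subset)
  ultimately have "((\<lambda>w. f (w + c)) has_derivative D) (at w within S)"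
    using has_derivative_in_compose[of "\<lambda>w. w + c" "\<lambda>v. v" w S f D] by simp
  with D(2) show "\<exists>D. ((\<lambda>w. f (w + c)) has_derivative D) (at w within S) \<and> (\<forall>c v. D (c *s v) = c * D v)"
    by blast
qed

lemma has_derivative_smult_left: "((\<lambda>z. z *s v) has_derivative (\<lambda>z. z *s v)) (at z within S)"
  for v :: "complex^2"
  by (intro bounded_linear_imp_has_derivative bounded_linear_intro[where K = "norm v"])
    (auto simp: norm_smult_complex vector_sadd_rdistrib scaleR_eq_smult vector_smult_assoc
      scaleR_conv_of_real)

lemma slice_has_field_derivative:
  fixes f :: "complex^2 \<Rightarrow> complex"
  assumes "(f has_derivative D) (at (w + z *s v))" "\<And>c v. D (c *s v) = c * D v"
  shows "((\<lambda>z. f (w + z *s v)) has_field_derivative D v) (at z)"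
proof -
  have "((\<lambda>z. w + z *s v) has_derivative (\<lambda>z. z *s v)) (at z)"
    by (rule has_derivative_eq_rhs[OF has_derivative_add[OF has_derivative_const has_derivative_smult_left]]) simp
  from has_derivative_compose[OF this assms(1)] show ?thesis
    unfolding has_field_derivative_def
    by (rule has_derivative_eq_rhs) (auto simp: assms(2) mult.commute)
qed

lemma slice_holomorphic_on:
  assumes "holomorphic2_on f S" "open S" "\<And>z. z \<in> T \<Longrightarrow> w + z *s v \<in> S"
  shows "(\<lambda>z. f (w + z *s v)) holomorphic_on T"
  unfolding holomorphic_on_def field_differentiable_def
proof
  fix z assume "z \<in> T"
  then have "w + z *s v \<in> S" by (rule assms(3))
  then obtain D where "(f has_derivative D) (at (w + z *s v))" "\<forall>c v. D (c *s v) = c * D v"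
    using assms(1,2) unfolding holomorphic2_on_def by (metis at_within_open)
  then show "\<exists>f'. ((\<lambda>z. f (w + z *s v)) has_field_derivative f') (at z within T)"
    using slice_has_field_derivative has_field_derivative_at_within by blast
qed

text \<open>Cauchy's estimate in one variable, applied to the restriction of \<open>f\<close> to the complex line
  through \<open>w\<close> in the direction \<open>v\<close>, controls the whole derivative.\<close>

lemma Cauchy_derivative_bound:
  assumes f: "holomorphic2_on f S" and S: "open S" "cball w \<rho> \<subseteq> S" and \<rho>: "\<rho> > 0"
    and B: "\<And>x. x \<in> S \<Longrightarrow> norm (f x) \<le> B"
    and D: "(f has_derivative D) (at w)" "\<And>c v. D (c *s v) = c * D v"
  shows "norm (D v) \<le> B / \<rho> * norm v"
proof (cases "v = 0")
  case True
  then show ?thesis using D(2)[of 0 0] by simp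
next
  case False
  define r where "r = \<rho> / norm v"
  have r: "r > 0" using False \<rho> by (simp add: r_def)
  have inS: "w + z *s v \<in> S" if "z \<in> cball 0 r" for z
  proof -
    have "norm (z *s v) \<le> \<rho>"
      using that False by (simp add: norm_smult_complex r_def field_simps)
    then have "w + z *s v \<in> cball w \<rho>" by (simp add: dist_norm)
    then show ?thesis using S by blast
  qed
  have hol: "(\<lambda>z. f (w + z *s v)) holomorphic_on cball 0 r"
    using slice_holomorphic_on[OF f S(1)] inS by blast
  have "norm ((deriv ^^ 1) (\<lambda>z. f (w + z *s v)) 0) \<le> fact 1 * B / r ^ 1"
    using hol r inS B
    by (intro Cauchy_inequality)
      (auto intro: holomorphic_on_subset holomorphic_on_imp_continuous_on)
  moreover have "deriv (\<lambda>z. f (w + z *s v)) 0 = D v"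
    by (rule DERIV_imp_deriv) (use slice_has_field_derivative[of f D w 0 v] D in simp)
  ultimately show ?thesis by (simp add: r_def)
qed

lemma holomorphic2_on_Lipschitz:
  assumes f: "holomorphic2_on f S" and S: "open S" and C: "convex C" "\<And>w. w \<in> C \<Longrightarrow> cball w \<rho> \<subseteq> S"
    and \<rho>: "\<rho> > 0" and B: "\<And>x. x \<in> S \<Longrightarrow> norm (f x) \<le> B" and xy: "x \<in> C" "y \<in> C"
  shows "norm (f x - f y) \<le> B / \<rho> * norm (x - y)"
proof -
  have "\<forall>w\<in>C. \<exists>D. (f has_derivative D) (at w) \<and> (\<forall>c v. D (c *s v) = c * D v)"
  proof
    fix w assume "w \<in> C"
    then have "w \<in> S" using C(2) \<rho> by (meson centre_in_cball less_imp_le subsetD)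
    then show "\<exists>D. (f has_derivative D) (at w) \<and> (\<forall>c v. D (c *s v) = c * D v)"
      using f S unfolding holomorphic2_on_def by (metis at_within_open)
  qed
  then obtain D where D: "\<And>w. w \<in> C \<Longrightarrow> (f has_derivative D w) (at w)"
    "\<And>w c v. w \<in> C \<Longrightarrow> D w (c *s v) = c * D w v" by metis
  show ?thesis
  proof (rule differentiable_bound[OF C(1) _ _ xy])
    show "(f has_derivative D w) (at w within C)" if "w \<in> C" for w
      using D(1)[OF that] by (rule has_derivative_at_withinI)
    show "onorm (D w) \<le> B / \<rho>" if "w \<in> C" for w
      using Cauchy_derivative_bound[OF f S C(2)[OF that] \<rho> B D(1)[OF that] D(2)[OF that]]
      by (intro onorm_le)
  qed
qed

text \<open>By Cauchy's estimate the derivatives converge locally uniformly along with the functions. So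
  the limit is differentiable, and its derivative is complex-linear as a limit of
  complex-linear maps.\<close>

lemma holomorphic2_on_uniform_limit:
  assumes f: "\<And>n::nat. holomorphic2_on (f n) S" and S: "open S"
    and lim: "uniform_limit S f g sequentially"
  shows "holomorphic2_on g S"
  unfolding holomorphic2_on_def
proof
  fix w assume w: "w \<in> S"
  then obtain \<rho>' where "\<rho>' > 0" "cball w \<rho>' \<subseteq> S"
    using S open_contains_cball by blast
  define \<rho> where "\<rho> = \<rho>' / 2"
  have \<rho>: "\<rho> > 0" using \<open>\<rho>' > 0\<close> by (simp add: \<rho>_def)
  have sub: "cball x \<rho> \<subseteq> S" if "x \<in> ball w \<rho>" for x
  proof -
    have "cball x \<rho> \<subseteq> cball w \<rho>'"
      using that \<open>\<rho>' > 0\<close> unfolding \<rho>_def by (intro cball_subset_cball_iff[THEN iffD2]) (auto simp: dist_commute)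
    then show ?thesis using \<open>cball w \<rho>' \<subseteq> S\<close> by blast
  qed
  have "\<forall>n. \<forall>x\<in>S. \<exists>D. (f n has_derivative D) (at x) \<and> (\<forall>c v. D (c *s v) = c * D v)"
    using f S unfolding holomorphic2_on_def by (metis at_within_open)
  then obtain D where D: "\<And>n x. x \<in> S \<Longrightarrow> (f n has_derivative D n x) (at x)"
    "\<And>n x c v. x \<in> S \<Longrightarrow> D n x (c *s v) = c * D n x v" by metis
  have bSs: "x \<in> S" if "x \<in> ball w \<rho>" for x
    using sub[OF that] \<rho> by auto
  have unif: "\<exists>N. \<forall>m\<ge>N. \<forall>n\<ge>N. \<forall>x\<in>ball w \<rho>. \<forall>h. norm (D m x h - D n x h) \<le> e * norm h"
    if e: "e > 0" for e
  proof -
    have "uniformly_Cauchy_on S f"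
      using lim uniformly_convergent_Cauchy uniformly_convergentI by blast
    then obtain N where N: "\<And>m n x. m \<ge> N \<Longrightarrow> n \<ge> N \<Longrightarrow> x \<in> S \<Longrightarrow> dist (f m x) (f n x) < e * \<rho>"
      using e \<rho> unfolding uniformly_Cauchy_on_def by (metis mult_pos_pos)
    have "norm (D m x h - D n x h) \<le> e * norm h" if "m \<ge> N" "n \<ge> N" "x \<in> ball w \<rho>" for m n x h
    proof -
      have "norm ((\<lambda>h. D m x h - D n x h) h) \<le> (e * \<rho>) / \<rho> * norm h"
      proof (rule Cauchy_derivative_bound[OF _ S sub[OF that(3)] \<rho>])
        show "holomorphic2_on (\<lambda>x. f m x - f n x) S" by (intro holomorphic2_on_diff f)
        show "norm (f m x - f n x) \<le> e * \<rho>" if "x \<in> S" for x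
          using N[OF \<open>m \<ge> N\<close> \<open>n \<ge> N\<close> that] by (simp add: dist_norm)
        show "((\<lambda>x. f m x - f n x) has_derivative (\<lambda>h. D m x h - D n x h)) (at x)"
          by (intro has_derivative_diff D bSs that)
        show "\<And>c v. D m x (c *s v) - D n x (c *s v) = c * (D m x v - D n x v)"
          using D(2)[OF bSs[OF that(3)]] by (simp add: algebra_simps)
      qed
      then show ?thesis using \<rho> by simp
    qed
    then show ?thesis by blast
  qed
  define D' where "D' x h = lim (\<lambda>n. D n x h)" for x h
  have conv: "(\<lambda>n. D n x h) \<longlonglongrightarrow> D' x h" if x: "x \<in> ball w \<rho>" for x h
  proof -
    have "Cauchy (\<lambda>n. D n x h)"
    proof (rule metric_CauchyI)
      fix e :: real assume e: "e > 0"
      then have e': "e / (norm h + 1) > 0" by (simp add: add_nonneg_pos)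
      from unif[OF this] obtain N where
        N: "\<And>m n. m \<ge> N \<Longrightarrow> n \<ge> N \<Longrightarrow> norm (D m x h - D n x h) \<le> e / (norm h + 1) * norm h"
        using x by blast
      have "e / (norm h + 1) * norm h < e"
        using e by (simp add: pos_divide_less_eq add_nonneg_pos distrib_left)
      then show "\<exists>M. \<forall>m\<ge>M. \<forall>n\<ge>M. dist (D m x h) (D n x h) < e"
        using N unfolding dist_norm by (intro exI[of _ N] allI impI) (rule order_le_less_trans)
    qed
    then show ?thesis
      unfolding D'_def using Cauchy_convergent_iff convergent_LIMSEQ_iff by blast
  qed
  have "\<exists>g'. \<forall>x\<in>ball w \<rho>. (\<lambda>n. f n x) \<longlonglongrightarrow> g' x \<and> (g' has_derivative D' x) (at x within ball w \<rho>)"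
  proof (rule has_derivative_sequence)
    show "(f n has_derivative D n x) (at x within ball w \<rho>)" if "x \<in> ball w \<rho>" for n x
      using D(1)[OF bSs[OF that]] by (rule has_derivative_at_withinI)
    show "w \<in> ball w \<rho>" using \<rho> by simp
    show "(\<lambda>n. f n w) \<longlonglongrightarrow> g w" using lim w by (rule tendsto_uniform_limitI)
    show "\<forall>\<^sub>F n in sequentially. \<forall>x\<in>ball w \<rho>. \<forall>h. norm (D n x h - D' x h) \<le> e * norm h" if "e > 0" for e
    proof -
      obtain N where N: "\<And>m n x h. m \<ge> N \<Longrightarrow> n \<ge> N \<Longrightarrow> x \<in> ball w \<rho> \<Longrightarrow>
          norm (D m x h - D n x h) \<le> e * norm h"
        using unif[OF \<open>e > 0\<close>] by blast
      have "norm (D n x h - D' x h) \<le> e * norm h" if "n \<ge> N" "x \<in> ball w \<rho>" for n x h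
      proof (rule tendsto_upperbound)
        show "(\<lambda>m. norm (D n x h - D m x h)) \<longlonglongrightarrow> norm (D n x h - D' x h)"
          by (intro tendsto_intros conv that)
        show "\<forall>\<^sub>F m in sequentially. norm (D n x h - D m x h) \<le> e * norm h"
          using N[OF that(1) _ that(2)] eventually_at_top_linorder by blast
      qed simp
      then show ?thesis unfolding eventually_at_top_linorder by blast
    qed
  qed simp
  then obtain g' where g': "\<And>x. x \<in> ball w \<rho> \<Longrightarrow> (\<lambda>n. f n x) \<longlonglongrightarrow> g' x"
    "\<And>x. x \<in> ball w \<rho> \<Longrightarrow> (g' has_derivative D' x) (at x within ball w \<rho>)" by blast
  have "g' x = g x" if "x \<in> ball w \<rho>" for x
    using g'(1)[OF that] tendsto_uniform_limitI[OF lim bSs[OF that]] LIMSEQ_unique by blast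
  with g'(2)[of w] \<rho> have "(g has_derivative D' w) (at w within ball w \<rho>)"
    by (metis centre_in_ball has_derivative_transform)
  then have "(g has_derivative D' w) (at w within S)"
    using \<rho> by (metis at_within_open centre_in_ball has_derivative_at_withinI open_ball)
  moreover have "D' w (c *s v) = c * D' w v" for c v
  proof (rule LIMSEQ_unique)
    show "(\<lambda>n. D n w (c *s v)) \<longlonglongrightarrow> D' w (c *s v)" by (rule conv) (use \<rho> in simp)
    show "(\<lambda>n. D n w (c *s v)) \<longlonglongrightarrow> c * D' w v"
      unfolding D(2)[OF w] by (intro tendsto_intros conv) (use \<rho> in simp)
  qed
  ultimately show "\<exists>D. (g has_derivative D) (at w within S) \<and> (\<forall>c v. D (c *s v) = c * D v)"
    by blast
qed

section \<open>Lines in the plane and two-by-two matrices\<close>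

definition det2 :: "complex^2 \<Rightarrow> complex^2 \<Rightarrow> complex"
  where "det2 v w = v $ 1 * w $ 2 - v $ 2 * w $ 1"

lemma vec2_eq_iff: "v = w \<longleftrightarrow> v $ 1 = w $ 1 \<and> v $ 2 = w $ 2" for v w :: "'a^2"
  by (simp add: vec_eq_iff forall_2)

lemma matrix_vector_mult_2: "(M *v v) $ i = M $ i $ 1 * v $ 1 + M $ i $ 2 * v $ 2"
  for M :: "complex^2^2"
  by (simp add: matrix_vector_mult_def sum_2)

lemma matrix_matrix_mult_2: "(A ** B) $ i $ k = A $ i $ 1 * B $ 1 $ k + A $ i $ 2 * B $ 2 $ k"
  for A B :: "complex^2^2"
  by (simp add: matrix_matrix_mult_def sum_2)

lemma norm_vec2_le: "norm v \<le> norm (v $ 1) + norm (v $ 2)" for v :: "'a::real_normed_vector^2"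
  unfolding norm_vec_def using L2_set_le_sum[of UNIV "\<lambda>i. norm (v $ i)"] by (simp add: sum_2)

lemma det2_matrix: "det2 (M *v v) (M *v w) = det M * det2 v w"
  by (simp add: det2_def matrix_vector_mult_2 det_2 algebra_simps)

lemma norm_det2_le: "norm (det2 v w) \<le> 2 * norm v * norm w"
proof -
  have "norm (v $ i * w $ k) \<le> norm v * norm w" for i k
    unfolding norm_mult by (intro mult_mono) (auto simp: Finite_Cartesian_Product.norm_nth_le)
  then have "norm (v $ 1 * w $ 2) + norm (v $ 2 * w $ 1) \<le> norm v * norm w + norm v * norm w"
    by (intro add_mono)
  then show ?thesis
    unfolding det2_def using norm_triangle_ineq4[of "v $ 1 * w $ 2" "v $ 2 * w $ 1"] by linarith
qed

text \<open>Cramer's rule: the coordinates of \<open>v\<close> in the basis \<open>s, u\<close> are quotients of determinants.\<close>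

lemma det2_expand: "det2 s u *s v = det2 v u *s s + det2 s v *s u"
  by (simp add: vec2_eq_iff det2_def algebra_simps)

lemma det2_eq_0_iff:
  assumes "v \<noteq> 0"
  shows "det2 v w = 0 \<longleftrightarrow> (\<exists>c. w = c *s v)"
proof
  assume *: "det2 v w = 0"
  from assms consider "v $ 1 \<noteq> 0" | "v $ 2 \<noteq> 0" by (auto simp: vec2_eq_iff)
  then show "\<exists>c. w = c *s v"
  proof cases
    case 1
    then show ?thesis using * by (intro exI[of _ "w $ 1 / v $ 1"]) (auto simp: vec2_eq_iff det2_def field_simps)
  next
    case 2
    then show ?thesis using * by (intro exI[of _ "w $ 2 / v $ 2"]) (auto simp: vec2_eq_iff det2_def field_simps)
  qed
qed (auto simp: det2_def)

lemma norm_matrix_vector_le: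
  fixes M :: "complex^2^2"
  assumes "\<And>i k. norm (M $ i $ k) \<le> K"
  shows "norm (M *v v) \<le> 4 * K * norm v"
proof -
  have "norm (M $ i $ k * v $ k) \<le> K * norm v" for i k
    unfolding norm_mult using assms[of i k] Finite_Cartesian_Product.norm_nth_le[of v k]
    by (intro mult_mono) (auto intro: order_trans[OF norm_ge_zero])
  then have "norm ((M *v v) $ i) \<le> K * norm v + K * norm v" for i
    unfolding matrix_vector_mult_2 by (intro order_trans[OF norm_triangle_ineq] add_mono) auto
  from add_mono[OF this[of 1] this[of 2]] norm_vec2_le[of "M *v v"] show ?thesis by linarith
qed

text \<open>The adjugate matrix, whose entries have the same bound, recovers \<open>det M *s v\<close> from \<open>M *v v\<close>.\<close>

lemma norm_matrix_vector_ge: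
  fixes M :: "complex^2^2"
  assumes "\<And>i k. norm (M $ i $ k) \<le> K"
  shows "norm (det M) * norm v \<le> 4 * K * norm (M *v v)"
proof -
  define N :: "complex^2^2" where
    "N = (\<chi> i k. if i = k then (if i = 1 then M $ 2 $ 2 else M $ 1 $ 1) else - M $ i $ k)"
  have "N *v (M *v v) = det M *s v"
    by (simp add: vec2_eq_iff matrix_vector_mult_2 N_def det_2 algebra_simps)
  then have "norm (det M) * norm v = norm (N *v (M *v v))" by (simp add: norm_smult_complex)
  also have "\<dots> \<le> 4 * K * norm (M *v v)"
    by (rule norm_matrix_vector_le) (auto simp: N_def assms)
  finally show ?thesis .
qed

lemma matrix_vector_nonzero: "det M \<noteq> 0 \<Longrightarrow> v \<noteq> 0 \<Longrightarrow> M *v v \<noteq> 0" for M :: "complex^2^2"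
  by (metis invertible_det_nz matrix_left_invertible_ker invertible_def)

lemma Rep_line_through:
  assumes "v \<noteq> 0"
  shows "Rep_cp1 (line_through v) = range (\<lambda>c. c *s v)"
proof -
  have "vec.dim (vec.span {v}) = 1"
    using assms by (subst vec.dim_span, subst vec.dim_eq_card_independent) auto
  then show ?thesis
    unfolding line_through_def vec.span_singleton[symmetric]
    by (subst Abs_cp1_inverse) (auto simp del: vec.span_singleton)
qed

lemma line_through_mem: "v \<noteq> 0 \<Longrightarrow> v \<in> Rep_cp1 (line_through v)"
  using Rep_line_through by (metis rangeI vector_smult_lid)

lemma line_through_eqI: "c \<noteq> 0 \<Longrightarrow> line_through (c *s v) = line_through v"
  unfolding line_through_def vec.span_singleton
proof (rule arg_cong[where f = Abs_cp1])
  assume c: "c \<noteq> 0"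
  show "range (\<lambda>k. k *s (c *s v)) = range (\<lambda>k. k *s v)"
  proof (intro subset_antisym subsetI)
    fix x assume "x \<in> range (\<lambda>k. k *s v)"
    then obtain k where "x = k *s v" by blast
    then have "x = (k / c) *s (c *s v)" using c by (simp add: vector_smult_assoc)
    then show "x \<in> range (\<lambda>k. k *s (c *s v))" by blast
  qed (auto simp: vector_smult_assoc)
qed

lemma line_through_eq_iff:
  assumes "v \<noteq> 0" "w \<noteq> 0"
  shows "line_through v = line_through w \<longleftrightarrow> det2 v w = 0"
proof
  assume "line_through v = line_through w"
  then have "w \<in> range (\<lambda>c. c *s v)"
    using assms line_through_mem Rep_line_through by metis
  then show "det2 v w = 0" using det2_eq_0_iff[OF assms(1)] by auto
next
  assume "det2 v w = 0"
  then obtain c where "w = c *s v" using det2_eq_0_iff[OF assms(1)] by auto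
  moreover have "c \<noteq> 0" using assms(2) calculation by auto
  ultimately show "line_through v = line_through w" using line_through_eqI by metis
qed

lemma cp1_eq_line_through:
  assumes "v \<in> Rep_cp1 L" "v \<noteq> 0"
  shows "L = line_through v"
proof -
  have L: "vec.subspace (Rep_cp1 L)" "vec.dim (Rep_cp1 L) = 1"
    using Rep_cp1[of L] by auto
  have "Rep_cp1 L \<subseteq> vec.span {v}"
    using vec.card_ge_dim_independent[of "{v}" "Rep_cp1 L"] assms L by auto
  moreover have "vec.span {v} \<subseteq> Rep_cp1 L"
    using vec.span_minimal[of "{v}"] assms L by auto
  ultimately have "Rep_cp1 L = Rep_cp1 (line_through v)"
    using Rep_line_through[OF assms(2)] by (simp add: vec.span_singleton)
  then show ?thesis by (simp add: Rep_cp1_inject)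
qed

lemma obtain_unit_vector:
  obtains v where "v \<in> Rep_cp1 L" "norm v = 1"
proof -
  have L: "vec.subspace (Rep_cp1 L)" "vec.dim (Rep_cp1 L) = 1"
    using Rep_cp1[of L] by auto
  have "\<not> Rep_cp1 L \<subseteq> {0}" using L(2) vec.dim_eq_0[of "Rep_cp1 L"] by simp
  then obtain v where v: "v \<in> Rep_cp1 L" "v \<noteq> 0" by blast
  have "of_real (1 / norm v) *s v \<in> Rep_cp1 L" using L v vec.subspace_scale by blast
  moreover have "norm (of_real (1 / norm v) *s v) = 1" using v by (simp add: norm_smult_complex norm_divide)
  ultimately show thesis using that by blast
qed

lemma proj_act_line_through: "v \<noteq> 0 \<Longrightarrow> proj_act M (line_through v) = line_through (M *v v)"
  unfolding proj_act_def Rep_line_through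
  by (simp add: line_through_def vec.span_singleton image_image vector_scalar_commute)

lemma chart_domain_line_through: "v \<noteq> 0 \<Longrightarrow> line_through v \<in> chart_domain i \<longleftrightarrow> v $ i \<noteq> 0"
  by (auto simp: chart_domain_def Rep_line_through intro: exI[of _ 1])

lemma chart_rep_line_through:
  fixes v :: "complex^2"
  assumes "v $ i \<noteq> 0"
  shows "chart_rep i (line_through v) = (1 / v $ i) *s v"
proof -
  have v: "v \<noteq> 0" using assms by auto
  show ?thesis
    unfolding chart_rep_def
  proof (rule the_equality)
    show "(1 / v $ i) *s v \<in> Rep_cp1 (line_through v) \<and> ((1 / v $ i) *s v) $ i = 1"
      using assms by (auto simp: Rep_line_through[OF v])
  next
    fix x assume "x \<in> Rep_cp1 (line_through v) \<and> x $ i = 1"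
    then have "\<exists>c. x = c *s v \<and> c * v $ i = 1"
      unfolding Rep_line_through[OF v] by (metis vector_smult_component rangeE)
    then obtain c where "x = c *s v" "c * v $ i = 1" by blast
    then show "x = (1 / v $ i) *s v" using assms by (simp add: nonzero_eq_divide_eq)
  qed
qed

lemma isCont_line_through:
  assumes "v \<noteq> 0"
  shows "isCont line_through v"
proof -
  have op: "open {v :: complex^2. v \<noteq> 0}" by (simp add: open_Collect_neq)
  have "continuous_on {v. v \<noteq> 0} line_through"
    unfolding continuous_on_open_vimage[OF op]
  proof (intro allI impI)
    fix B :: "cp1 set" assume "open B"
    then have "open {v. v \<noteq> 0 \<and> line_through v \<in> B}" by (simp add: open_cp1_def)
    then show "open (line_through -` B \<inter> {v. v \<noteq> 0})"
      by (rule back_subst[where P = "open"]) auto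
  qed
  then show ?thesis using continuous_on_eq_continuous_at[OF op] assms by blast
qed

text \<open>The entries of the orthogonal projection onto a line depend continuously on the line.
  They give access to the angle between two lines without a choice of spanning vectors.\<close>

definition line_proj :: "2 \<Rightarrow> 2 \<Rightarrow> cp1 \<Rightarrow> complex"
  where "line_proj i k L = (let v = (SOME v. v \<in> Rep_cp1 L \<and> norm v = 1) in v $ i * cnj (v $ k))"

lemma line_proj_line_through:
  assumes "v \<noteq> 0"
  shows "line_proj i k (line_through v) = v $ i * cnj (v $ k) / of_real ((norm v)\<^sup>2)"
proof -
  define w where "w = (SOME w. w \<in> Rep_cp1 (line_through v) \<and> norm w = 1)"
  have "w \<in> Rep_cp1 (line_through v) \<and> norm w = 1"
    unfolding w_def by (rule someI_ex) (meson obtain_unit_vector)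
  then have "\<exists>c. w = c *s v \<and> norm c * norm v = 1"
    unfolding Rep_line_through[OF assms] by (metis norm_smult_complex rangeE)
  then obtain c where c: "w = c *s v" "norm c * norm v = 1" by blast
  have "c * cnj c * of_real ((norm v)\<^sup>2) = of_real ((norm c * norm v)\<^sup>2)"
    by (simp only: complex_norm_square[symmetric] of_real_mult power_mult_distrib of_real_power)
  then have "c * cnj c * of_real ((norm v)\<^sup>2) = 1" using c by simp
  then have "c * cnj c = 1 / of_real ((norm v)\<^sup>2)"
    using assms by (simp add: nonzero_eq_divide_eq)
  moreover have "line_proj i k (line_through v) = c * cnj c * (v $ i * cnj (v $ k))"
    unfolding line_proj_def w_def[symmetric] Let_def c(1) by simp
  ultimately show ?thesis by simp
qed

lemma line_proj_unit:
  assumes "v \<in> Rep_cp1 L" "norm v = 1"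
  shows "line_proj i k L = v $ i * cnj (v $ k)"
proof -
  have "v \<noteq> 0" using assms by auto
  with cp1_eq_line_through[OF assms(1)] line_proj_line_through[of v] show ?thesis
    using assms(2) by simp
qed

lemma continuous_on_line_proj: "continuous_on UNIV (line_proj i k)"
  unfolding continuous_on_open_vimage[OF open_UNIV]
proof (intro allI impI)
  fix B :: "complex set" assume B: "open B"
  have op: "open {v :: complex^2. v \<noteq> 0}" by (simp add: open_Collect_neq)
  have "continuous_on {v. v \<noteq> 0} (\<lambda>v :: complex^2. v $ i * cnj (v $ k) / of_real ((norm v)\<^sup>2))"
    by (intro continuous_intros) auto
  then have "open ((\<lambda>v :: complex^2. v $ i * cnj (v $ k) / of_real ((norm v)\<^sup>2)) -` B \<inter> {v. v \<noteq> 0})"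
    using B unfolding continuous_on_open_vimage[OF op] by blast
  then show "open (line_proj i k -` B \<inter> UNIV)"
    unfolding open_cp1_def
    by (rule back_subst[where P = "open"]) (auto simp: line_proj_line_through)
qed

text \<open>For unit vectors \<open>v\<close>, \<open>w\<close> this expands \<open>det2 v w * cnj (det2 v w)\<close> into entries of the two
  projections.\<close>

definition sin_angle_sq :: "cp1 \<Rightarrow> cp1 \<Rightarrow> complex"
  where "sin_angle_sq L K =
    line_proj 1 1 L * line_proj 2 2 K + line_proj 2 2 L * line_proj 1 1 K
    - line_proj 1 2 L * line_proj 2 1 K - line_proj 2 1 L * line_proj 1 2 K"

lemma sin_angle_sq_eq:
  assumes "v \<in> Rep_cp1 L" "norm v = 1" "w \<in> Rep_cp1 K" "norm w = 1"
  shows "sin_angle_sq L K = of_real ((norm (det2 v w))\<^sup>2)"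
  unfolding sin_angle_sq_def line_proj_unit[OF assms(1,2)] line_proj_unit[OF assms(3,4)]
    complex_norm_square det2_def by (simp add: algebra_simps)

text \<open>Expanding \<open>(M v)\<^sup>* (M v)\<close> produces the entries of \<open>M\<^sup>* M\<close> as coefficients.\<close>

lemma unitary_isometry:
  assumes "unitary M"
  shows "norm (M *v v) = norm v" and "norm (det M) = 1"
proof -
  define N :: "complex^2^2" where "N = (\<chi> i k. cnj (M $ k $ i))"
  have N: "N ** M = mat 1" using assms by (simp add: unitary_def N_def)
  have ent: "cnj (M $ 1 $ i) * M $ 1 $ k + cnj (M $ 2 $ i) * M $ 2 $ k = (if i = k then 1 else 0)" for i k
    using arg_cong[OF N, of "\<lambda>B. B $ i $ k"] by (simp add: matrix_matrix_mult_2 N_def mat_def)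
  have sq: "complex_of_real ((norm x)\<^sup>2) = x $ 1 * cnj (x $ 1) + x $ 2 * cnj (x $ 2)" for x :: "complex^2"
    by (simp add: norm_vec_def L2_set_def sum_2 complex_norm_square del: of_real_power)
  have "complex_of_real ((norm (M *v v))\<^sup>2) =
      (cnj (M $ 1 $ 1) * M $ 1 $ 1 + cnj (M $ 2 $ 1) * M $ 2 $ 1) * (v $ 1 * cnj (v $ 1))
    + (cnj (M $ 1 $ 2) * M $ 1 $ 2 + cnj (M $ 2 $ 2) * M $ 2 $ 2) * (v $ 2 * cnj (v $ 2))
    + (cnj (M $ 1 $ 1) * M $ 1 $ 2 + cnj (M $ 2 $ 1) * M $ 2 $ 2) * (cnj (v $ 1) * v $ 2)
    + (cnj (M $ 1 $ 2) * M $ 1 $ 1 + cnj (M $ 2 $ 2) * M $ 2 $ 1) * (v $ 1 * cnj (v $ 2))"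
    unfolding sq matrix_vector_mult_2 by (simp add: algebra_simps)
  also have "\<dots> = complex_of_real ((norm v)\<^sup>2)" unfolding ent sq by simp
  finally have "(norm (M *v v))\<^sup>2 = (norm v)\<^sup>2" by (simp only: of_real_eq_iff)
  then show "norm (M *v v) = norm v" by simp
  have "det N = cnj (det M)" by (simp add: det_2 N_def)
  moreover have "det N * det M = 1" using N by (metis det_I det_mul)
  ultimately have "norm (det M) * norm (det M) = 1" by (metis complex_mod_cnj norm_mult norm_one)
  then show "norm (det M) = 1" by (metis abs_norm_cancel power2_eq_square real_sqrt_abs real_sqrt_one)
qed

lemma matrix_inv_left: "invertible M \<Longrightarrow> matrix_inv M ** M = mat 1"
  unfolding invertible_def matrix_inv_def by (rule someI2_ex) auto

text \<open>On a line \<open>|M v| / |v|\<close> is constant, so that norm and conorm coincide.\<close>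

lemma norm_on_line_eq:
  assumes "v \<in> Rep_cp1 L" "v \<noteq> 0"
  shows "norm_on_line M L = norm (M *v v) / norm v" and "conorm_on_line M L = norm (M *v v) / norm v"
proof -
  have const: "norm (M *v x) = norm (M *v v) / norm v" if x: "x \<in> Rep_cp1 L" "norm x = 1" for x
  proof -
    obtain c where c: "x = c *s v"
      using x(1) cp1_eq_line_through[OF assms] Rep_line_through[OF assms(2)] by auto
    then have "norm c = 1 / norm v" using x(2) assms(2) by (simp add: norm_smult_complex field_simps)
    then show ?thesis by (simp add: c vector_scalar_commute norm_smult_complex)
  qed
  obtain x where "x \<in> Rep_cp1 L" "norm x = 1" using obtain_unit_vector .
  then have "(\<lambda>x. norm (M *v x)) ` {x \<in> Rep_cp1 L. norm x = 1} = {norm (M *v v) / norm v}"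
    using const by (auto intro!: image_eqI[of _ _ x])
  then show "norm_on_line M L = norm (M *v v) / norm v" "conorm_on_line M L = norm (M *v v) / norm v"
    unfolding norm_on_line_def conorm_on_line_def by simp_all
qed

text \<open>A line field is holomorphic if locally it is spanned by a nowhere zero holomorphic vector
  field: the chart coordinates are quotients of the components.\<close>

lemma cp1_holomorphic_on_line_through:
  assumes S: "open S"
    and loc: "\<And>w. w \<in> S \<Longrightarrow> \<exists>T v. open T \<and> w \<in> T \<and> (\<forall>i. holomorphic2_on (\<lambda>w. v w $ i) T) \<and>
      (\<forall>w\<in>S \<inter> T. v w \<noteq> 0 \<and> l w = line_through (v w))"
  shows "cp1_holomorphic_on l S"
  unfolding cp1_holomorphic_on_def
proof (intro conjI allI)
  show "continuous_on S l"
  proof (rule continuous_at_imp_continuous_on, rule ballI)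
    fix w assume w: "w \<in> S"
    obtain T v where T: "open T" "w \<in> T" "\<And>i. holomorphic2_on (\<lambda>w. v w $ i) T"
      and l: "\<And>w. w \<in> S \<Longrightarrow> w \<in> T \<Longrightarrow> v w \<noteq> 0 \<and> l w = line_through (v w)"
      using loc[OF w] by blast
    have "isCont (\<lambda>w. v w $ i) w" for i
      using holomorphic2_on_imp_continuous_on[OF T(3)] T(1,2) continuous_on_eq_continuous_at by blast
    then have "isCont v w" unfolding isCont_def by (intro vec_tendstoI)
    then have "isCont (\<lambda>w. line_through (v w)) w"
      using isCont_o2 isCont_line_through l[OF w T(2)] by blast
    moreover have "\<forall>\<^sub>F x in nhds w. l x = line_through (v x)"
      unfolding eventually_nhds using S T(1,2) w l by (intro exI[of _ "S \<inter> T"]) auto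
    ultimately show "isCont l w" using isCont_cong by metis
  qed
next
  fix i k
  show "holomorphic2_on (\<lambda>w. chart_rep i (l w) $ k) {w \<in> S. l w \<in> chart_domain i}" (is "holomorphic2_on _ ?D")
  proof (rule holomorphic2_on_locally)
    fix w assume "w \<in> ?D"
    then obtain T v where T: "open T" "w \<in> T" "\<And>i. holomorphic2_on (\<lambda>w. v w $ i) T"
      and l: "\<And>w. w \<in> S \<Longrightarrow> w \<in> T \<Longrightarrow> v w \<noteq> 0 \<and> l w = line_through (v w)"
      using loc[of w] by blast
    have nz: "v x $ i \<noteq> 0" if "x \<in> ?D \<inter> T" for x
      using that l[of x] chart_domain_line_through[of "v x" i] by auto
    have "chart_rep i (l x) $ k = v x $ k / v x $ i" if x: "x \<in> ?D \<inter> T" for x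
      using x l[of x] chart_rep_line_through[OF nz[OF x]] by simp
    moreover have "holomorphic2_on (\<lambda>x. v x $ k / v x $ i) (?D \<inter> T)"
      by (intro holomorphic2_on_divide holomorphic2_on_subset[OF T(3)] nz) auto
    ultimately have "holomorphic2_on (\<lambda>w. chart_rep i (l w) $ k) (?D \<inter> T)"
      by (subst holomorphic2_on_cong) auto
    then show "\<exists>T. open T \<and> w \<in> T \<and> holomorphic2_on (\<lambda>w. chart_rep i (l w) $ k) (?D \<inter> T)"
      using T by blast
  qed
qed

section \<open>Dominated directions\<close>

text \<open>A direction singled out by a sequence of matrices: some other direction grows infinitely
  faster. Being a statement about growth only, this needs no reference frame, so that directions
  constructed in different local frames can be compared.\<close>

definition dominated_direction :: "(nat \<Rightarrow> complex^2^2) \<Rightarrow> complex^2 \<Rightarrow> bool"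
  where "dominated_direction M v \<longleftrightarrow> v \<noteq> 0 \<and>
    (\<exists>u. u \<noteq> 0 \<and> (\<lambda>n. norm (M n *v v) / norm (M n *v u)) \<longlonglongrightarrow> 0)"

text \<open>Any vector independent of a dominated one dominates it: the witness \<open>u\<close> is a combination of \<open>v\<close>
  and \<open>w\<close>, and the contribution of \<open>v\<close> to the growth of \<open>u\<close> is negligible, so \<open>w\<close> grows at least at
  the rate of \<open>u\<close>.\<close>

lemma dominated_direction_beats_independent:
  assumes M: "\<And>n. det (M n) \<noteq> 0" and dom: "dominated_direction M v" and ind: "det2 v w \<noteq> 0"
  shows "(\<lambda>n. norm (M n *v v) / norm (M n *v w)) \<longlonglongrightarrow> 0"
proof -
  obtain u where v0: "v \<noteq> 0" and u0: "u \<noteq> 0"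
    and lim: "(\<lambda>n. norm (M n *v v) / norm (M n *v u)) \<longlonglongrightarrow> 0"
    using dom unfolding dominated_direction_def by blast
  define a b where "a = det2 u w / det2 v w" and "b = det2 v u / det2 v w"
  have u: "u = a *s v + b *s w"
  proof -
    have "(1 / det2 v w) *s (det2 v w *s u) = a *s v + b *s w"
      unfolding det2_expand[of v w u] a_def b_def vector_add_ldistrib vector_smult_assoc by simp
    then show ?thesis using ind by (simp add: vector_smult_assoc)
  qed
  have w0: "w \<noteq> 0" using ind by (auto simp: det2_def)
  define f where "f x n = norm (M n *v x)" for x n
  have pos: "f x n > 0" if "x \<noteq> 0" for x n
    using matrix_vector_nonzero[OF M that] by (simp add: f_def)
  have tri: "f u n \<le> norm a * f v n + norm b * f w n" for n
  proof -
    have "M n *v u = a *s (M n *v v) + b *s (M n *v w)"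
      unfolding u by (simp add: matrix_vector_right_distrib vector_scalar_commute)
    then show ?thesis
      unfolding f_def by (metis norm_smult_complex norm_triangle_ineq)
  qed
  have "\<forall>\<^sub>F n in sequentially. f v n / f u n < 1 / (2 * (norm a + 1))"
    using lim unfolding f_def
    by (rule order_tendstoD) (simp add: add_nonneg_pos)
  then have ev: "\<forall>\<^sub>F n in sequentially. f v n / f w n \<le> 2 * norm b * (f v n / f u n)"
  proof eventually_elim
    case (elim n)
    have "2 * (norm a + 1) * f v n < f u n"
      using elim pos[OF u0, of n] by (simp add: pos_divide_less_eq pos_less_divide_eq add_nonneg_pos mult_ac)
    then have "f u n \<le> 2 * norm b * f w n"
      using tri[of n] pos[OF v0, of n] by (simp add: algebra_simps)
    then have "f v n * f u n \<le> f v n * (2 * norm b * f w n)"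
      by (intro mult_left_mono) (auto simp: f_def)
    then show ?case using pos[OF u0, of n] pos[OF w0, of n]
      by (simp add: divide_simps mult_ac)
  qed
  have "(\<lambda>n. f v n / f w n) \<longlonglongrightarrow> 0"
  proof (rule tendsto_sandwich[OF _ ev tendsto_const])
    show "(\<lambda>n. 2 * norm b * (f v n / f u n)) \<longlonglongrightarrow> 0"
      using tendsto_mult_right_zero[OF lim, of "2 * norm b"] by (simp add: f_def)
  qed (auto simp: f_def)
  then show ?thesis by (simp add: f_def)
qed

text \<open>Of two independent dominated directions, each would be infinitely slower than the other.\<close>

lemma dominated_direction_unique:
  assumes M: "\<And>n. det (M n) \<noteq> 0" and v: "dominated_direction M v" "dominated_direction M w"
  shows "line_through v = line_through w"
proof (rule ccontr)
  assume "line_through v \<noteq> line_through w"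
  moreover have 0: "v \<noteq> 0" "w \<noteq> 0" using v by (auto simp: dominated_direction_def)
  ultimately have ind: "det2 v w \<noteq> 0" "det2 w v \<noteq> 0"
    using line_through_eq_iff by metis+
  have "(\<lambda>n. (norm (M n *v v) / norm (M n *v w)) * (norm (M n *v w) / norm (M n *v v))) \<longlonglongrightarrow> 0 * 0"
    using dominated_direction_beats_independent[OF M] v ind by (intro tendsto_mult) auto
  moreover have "(norm (M n *v v) / norm (M n *v w)) * (norm (M n *v w) / norm (M n *v v)) = 1" for n
    using matrix_vector_nonzero[OF M[of n]] 0 by simp
  ultimately show False using LIMSEQ_unique[OF tendsto_const] by fastforce
qed

definition slow_line :: "(nat \<Rightarrow> complex^2^2) \<Rightarrow> cp1"
  where "slow_line M = line_through (SOME v. dominated_direction M v)"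

lemma slow_line_eq:
  assumes "\<And>n. det (M n) \<noteq> 0" "dominated_direction M v"
  shows "slow_line M = line_through v"
  unfolding slow_line_def using assms dominated_direction_unique someI[of "dominated_direction M" v] by blast

text \<open>Factors bounded from above and below do not affect which of two vectors grows faster. This
  covers both the sewing maps and the passage to the next point of
  an orbit.\<close>

lemma dominated_direction_transfer:
  assumes B: "det B \<noteq> 0" and c: "c > 0"
    and le: "\<And>n x. norm (M' n *v (B *v x)) \<le> K * norm (M n *v x)"
    and ge: "\<And>n x. c * norm (M n *v x) \<le> norm (M' n *v (B *v x))"
    and M: "\<And>n. det (M n) \<noteq> 0" and dom: "dominated_direction M v"
  shows "dominated_direction M' (B *v v)"
proof -
  obtain u where v0: "v \<noteq> 0" and u0: "u \<noteq> 0"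
    and lim: "(\<lambda>n. norm (M n *v v) / norm (M n *v u)) \<longlonglongrightarrow> 0"
    using dom unfolding dominated_direction_def by blast
  have pos: "norm (M n *v u) > 0" for n
    using matrix_vector_nonzero[OF M u0] by simp
  have "(\<lambda>n. norm (M' n *v (B *v v)) / norm (M' n *v (B *v u))) \<longlonglongrightarrow> 0"
  proof (rule tendsto_sandwich[OF _ _ tendsto_const])
    show "\<forall>\<^sub>F n in sequentially. norm (M' n *v (B *v v)) / norm (M' n *v (B *v u))
        \<le> K / c * (norm (M n *v v) / norm (M n *v u))"
    proof (rule always_eventually, rule allI)
      fix n
      have "norm (M' n *v (B *v v)) / norm (M' n *v (B *v u)) \<le> (K * norm (M n *v v)) / (c * norm (M n *v u))"
        using le[of n v] ge[of n u] pos[of n] c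
        by (intro frac_le) (auto intro: order_trans[OF norm_ge_zero])
      then show "norm (M' n *v (B *v v)) / norm (M' n *v (B *v u))
        \<le> K / c * (norm (M n *v v) / norm (M n *v u))" by simp
    qed
    show "(\<lambda>n. K / c * (norm (M n *v v) / norm (M n *v u))) \<longlonglongrightarrow> 0"
      using tendsto_mult_right_zero[OF lim] .
  qed auto
  then show ?thesis
    unfolding dominated_direction_def using matrix_vector_nonzero[OF B] v0 u0 by blast
qed

section \<open>The graph transform\<close>

text \<open>The inverse of the matrix with rows \<open>(p, q)\<close> and \<open>(r, e)\<close> sends the line of slope \<open>t\<close>, spanned
  by \<open>(1, t)\<close>, to the line of slope \<open>(p t - r) / (e - q t)\<close>. For \<open>q = r = 0\<close>, \<open>e = 1\<close> this is
  multiplication by \<open>p\<close>; a small perturbation remains a contraction of the unit disc.\<close>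

lemma graph_transform_step:
  fixes p q r e t t' :: complex and \<kappa> \<epsilon> :: real
  assumes p: "norm p \<le> \<kappa>" and q: "norm q \<le> \<epsilon>" and r: "norm r \<le> \<epsilon>" and e: "norm (e - 1) \<le> \<epsilon>"
    and \<epsilon>: "0 \<le> \<kappa>" "0 < \<epsilon>" "\<kappa> + 8 * \<epsilon> \<le> 1" and t: "norm t \<le> 1" "norm t' \<le> 1"
  shows "norm (e - q * t) \<ge> 1 - 2 * \<epsilon>"
    and "norm ((p * t - r) / (e - q * t)) \<le> 1"
    and "norm ((p * t - r) / (e - q * t) - (p * t' - r) / (e - q * t'))
      \<le> (\<kappa> + 2 * \<epsilon>) / (1 - 4 * \<epsilon>) * norm (t - t')"
proof -
  have den: "norm (e - q * t) \<ge> 1 - 2 * \<epsilon>" if "norm t \<le> 1" for t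
  proof -
    have "norm (q * t) \<le> \<epsilon> * 1" unfolding norm_mult using q that \<epsilon> by (intro mult_mono) auto
    moreover have "norm e \<ge> 1 - \<epsilon>" using e norm_triangle_ineq3[of e 1] by simp
    ultimately show ?thesis using norm_triangle_ineq2[of e "q * t"] by linarith
  qed
  show "norm (e - q * t) \<ge> 1 - 2 * \<epsilon>" by (rule den) fact
  have d: "1 - 2 * \<epsilon> > 0" using \<epsilon> by linarith
  have "norm (p * t) \<le> \<kappa> * 1" unfolding norm_mult using p t \<epsilon> by (intro mult_mono) auto
  then have "norm (p * t - r) \<le> 1 - 2 * \<epsilon>"
    using r \<epsilon> norm_triangle_ineq4[of "p * t" r] by linarith
  then show "norm ((p * t - r) / (e - q * t)) \<le> 1"
    using den[OF t(1)] d by (simp add: norm_divide divide_le_eq_1)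
  have n0: "e - q * t \<noteq> 0" "e - q * t' \<noteq> 0" using den[OF t(1)] den[OF t(2)] d by auto
  have eq: "(p * t - r) / (e - q * t) - (p * t' - r) / (e - q * t')
      = (p * e - r * q) * (t - t') / ((e - q * t) * (e - q * t'))"
    using n0 by (simp add: divide_simps) (simp add: algebra_simps)
  have ne: "norm e \<le> 1 + \<epsilon>" using e norm_triangle_sub[of e 1] by simp
  have "norm (p * e - r * q) \<le> \<kappa> * (1 + \<epsilon>) + \<epsilon> * \<epsilon>"
    using p q r ne \<epsilon>
    by (intro order_trans[OF norm_triangle_ineq4] add_mono; unfold norm_mult; intro mult_mono) auto
  also have "\<dots> \<le> \<kappa> + 2 * \<epsilon>"
  proof -
    have "\<kappa> * \<epsilon> \<le> 1 * \<epsilon>" "\<epsilon> * \<epsilon> \<le> 1 * \<epsilon>" using \<epsilon> by (auto intro!: mult_right_mono)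
    then show ?thesis by (simp add: algebra_simps)
  qed
  finally have num: "norm (p * e - r * q) \<le> \<kappa> + 2 * \<epsilon>" .
  have "1 - 4 * \<epsilon> \<le> (1 - 2 * \<epsilon>) * (1 - 2 * \<epsilon>)" by (simp add: algebra_simps)
  also have "\<dots> \<le> norm (e - q * t) * norm (e - q * t')"
    using den[OF t(1)] den[OF t(2)] d by (intro mult_mono) auto
  finally have den2: "1 - 4 * \<epsilon> \<le> norm (e - q * t) * norm (e - q * t')" .
  have "norm ((p * e - r * q) * (t - t') / ((e - q * t) * (e - q * t')))
      = norm (p * e - r * q) * norm (t - t') / (norm (e - q * t) * norm (e - q * t'))"
    by (simp add: norm_divide norm_mult)
  also have "\<dots> \<le> (\<kappa> + 2 * \<epsilon>) * norm (t - t') / (1 - 4 * \<epsilon>)"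
    using num den2 \<epsilon> by (intro frac_le mult_right_mono) auto
  finally show "norm ((p * t - r) / (e - q * t) - (p * t' - r) / (e - q * t'))
      \<le> (\<kappa> + 2 * \<epsilon>) / (1 - 4 * \<epsilon>) * norm (t - t')"
    unfolding eq by simp
qed

text \<open>The slope obtained at time \<open>n\<close> by pulling back the slope \<open>0\<close> from time \<open>n + k\<close>.\<close>

fun pullback_slope :: "(nat \<Rightarrow> 'a \<Rightarrow> complex) \<Rightarrow> (nat \<Rightarrow> 'a \<Rightarrow> complex) \<Rightarrow> (nat \<Rightarrow> 'a \<Rightarrow> complex)
    \<Rightarrow> (nat \<Rightarrow> 'a \<Rightarrow> complex) \<Rightarrow> nat \<Rightarrow> nat \<Rightarrow> 'a \<Rightarrow> complex"
  where
    "pullback_slope p q r e n 0 w = 0"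
  | "pullback_slope p q r e n (Suc k) w =
      (p n w * pullback_slope p q r e (Suc n) k w - r n w)
      / (e n w - q n w * pullback_slope p q r e (Suc n) k w)"

text \<open>The slope maps are contractions of the unit disc with a common constant, so the slopes pulled
  back from time \<open>n + k\<close> to time \<open>n\<close> form a Cauchy sequence in \<open>k\<close>, uniformly in \<open>w\<close>; and
  holomorphy survives in the limit.\<close>

lemma invariant_slopes:
  fixes p q r e :: "nat \<Rightarrow> complex^2 \<Rightarrow> complex" and \<kappa> \<epsilon> :: real
  assumes S: "open S"
    and hol: "\<And>n. holomorphic2_on (p n) S" "\<And>n. holomorphic2_on (q n) S"
      "\<And>n. holomorphic2_on (r n) S" "\<And>n. holomorphic2_on (e n) S"
    and p: "\<And>n w. w \<in> S \<Longrightarrow> norm (p n w) \<le> \<kappa>" and q: "\<And>n w. w \<in> S \<Longrightarrow> norm (q n w) \<le> \<epsilon>"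
    and r: "\<And>n w. w \<in> S \<Longrightarrow> norm (r n w) \<le> \<epsilon>" and e: "\<And>n w. w \<in> S \<Longrightarrow> norm (e n w - 1) \<le> \<epsilon>"
    and \<epsilon>: "0 \<le> \<kappa>" "0 < \<epsilon>" "\<kappa> + 8 * \<epsilon> \<le> 1"
  shows "\<exists>t. (\<forall>n. holomorphic2_on (t n) S) \<and> (\<forall>n. \<forall>w\<in>S. norm (t n w) \<le> 1 \<and>
    t n w * (e n w - q n w * t (Suc n) w) = p n w * t (Suc n) w - r n w)"
proof -
  define g where "g = pullback_slope p q r e"
  define \<theta> where "\<theta> = (\<kappa> + 2 * \<epsilon>) / (1 - 4 * \<epsilon>)"
  have \<theta>: "0 \<le> \<theta>" "\<theta> < 1" using \<epsilon> by (auto simp: \<theta>_def divide_simps)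
  note step = graph_transform_step[OF p q r e \<epsilon>]
  have g1: "norm (g n k w) \<le> 1" if "w \<in> S" for n k w
    using that
  proof (induction k arbitrary: n)
    case (Suc k)
    show ?case using step(2)[OF Suc.prems Suc.prems Suc.prems Suc.prems Suc.IH[OF Suc.prems], of 0]
      by (simp add: g_def)
  qed (simp add: g_def)
  have den: "e n w - q n w * t \<noteq> 0" if "w \<in> S" "norm t \<le> 1" for n w t
  proof -
    have "1 - 2 * \<epsilon> \<le> norm (e n w - q n w * t)"
      by (rule graph_transform_step(1)[OF p q r e \<epsilon> that(2) that(2)]) (rule that(1))+
    then show ?thesis using \<epsilon> by auto
  qed
  have ghol: "holomorphic2_on (g n k) S" for n k
  proof (induction k arbitrary: n)
    case 0
    have "g n 0 = (\<lambda>w. 0)" by (auto simp: g_def)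
    then show ?case by auto
  next
    case (Suc k)
    have *: "g n (Suc k) = (\<lambda>w. (p n w * g (Suc n) k w - r n w) / (e n w - q n w * g (Suc n) k w))"
      by (auto simp: g_def)
    show ?case unfolding * by (intro holomorphic2_on_divide holomorphic2_on_diff holomorphic2_on_mult hol Suc den g1)
  qed
  have gdiff: "norm (g n (Suc k) w - g n k w) \<le> \<theta> ^ k" if "w \<in> S" for n k w
  proof (induction k arbitrary: n)
    case 0
    then show ?case using g1[OF that, of n 1] by (simp add: g_def)
  next
    case (Suc k)
    have "norm (g n (Suc (Suc k)) w - g n (Suc k) w) \<le> \<theta> * norm (g (Suc n) (Suc k) w - g (Suc n) k w)"
      using step(3)[OF that that that that g1[OF that, of "Suc n" "Suc k"] g1[OF that, of "Suc n" k], of n n n n]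
      unfolding g_def \<theta>_def by (simp only: pullback_slope.simps(2))
    also have "\<dots> \<le> \<theta> * \<theta> ^ k" using Suc \<theta> by (intro mult_left_mono)
    finally show ?case by simp
  qed
  define t where "t n w = (\<Sum>k. g n (Suc k) w - g n k w)" for n w
  have unif: "uniform_limit S (g n) (t n) sequentially" for n
  proof -
    have "uniform_limit S (\<lambda>k w. \<Sum>i<k. g n (Suc i) w - g n i w) (t n) sequentially"
      unfolding t_def using gdiff \<theta> by (intro Weierstrass_m_test[where M = "\<lambda>k. \<theta> ^ k"]) auto
    moreover have "(\<Sum>i<k. g n (Suc i) w - g n i w) = g n k w" for k w
      by (subst sum_lessThan_telescope) (simp add: g_def)
    ultimately show ?thesis by simp
  qed
  have lim: "(\<lambda>k. g n k w) \<longlonglongrightarrow> t n w" if "w \<in> S" for n w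
    using tendsto_uniform_limitI[OF unif that] .
  have t1: "norm (t n w) \<le> 1" if "w \<in> S" for n w
    by (rule tendsto_upperbound[OF tendsto_norm[OF lim[OF that]]]) (auto simp: g1[OF that])
  have "t n w * (e n w - q n w * t (Suc n) w) = p n w * t (Suc n) w - r n w" if w: "w \<in> S" for n w
  proof -
    have "(\<lambda>k. (p n w * g (Suc n) k w - r n w) / (e n w - q n w * g (Suc n) k w))
        \<longlonglongrightarrow> (p n w * t (Suc n) w - r n w) / (e n w - q n w * t (Suc n) w)"
      by (intro tendsto_intros lim w den t1)
    moreover have "(\<lambda>k. g n (Suc k) w) \<longlonglongrightarrow> t n w" using lim[OF w] by (rule LIMSEQ_Suc)
    moreover have "g n (Suc k) w = (p n w * g (Suc n) k w - r n w) / (e n w - q n w * g (Suc n) k w)" for k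
      by (simp add: g_def)
    ultimately have "t n w = (p n w * t (Suc n) w - r n w) / (e n w - q n w * t (Suc n) w)"
      using LIMSEQ_unique by fastforce
    then show ?thesis using den[OF w t1[OF w]] by (simp add: nonzero_eq_divide_eq)
  qed
  moreover have "holomorphic2_on (t n) S" for n
    by (rule holomorphic2_on_uniform_limit[OF ghol S unif])
  ultimately show ?thesis using t1 by blast
qed

text \<open>Growth in frames: along the invariant slopes the first coordinate is multiplied by at most
  \<open>\<kappa> + \<epsilon>\<close> (up to the scalars \<open>b n\<close>), whereas in the cone around the second axis the second
  coordinate is multiplied by at least \<open>1 - 2 \<epsilon>\<close> (up to the same scalars).\<close>

lemma dominated_direction_frames:
  fixes H M :: "nat \<Rightarrow> complex^2^2" and s u :: "nat \<Rightarrow> complex^2" and p q r e b t :: "nat \<Rightarrow> complex"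
  assumes M0: "M 0 = mat 1" and MS: "\<And>n. M (Suc n) = H n ** M n"
    and Hs: "\<And>n. H n *v s n = b n *s (p n *s s (Suc n) + r n *s u (Suc n))"
    and Hu: "\<And>n. H n *v u n = b n *s (q n *s s (Suc n) + e n *s u (Suc n))"
    and b: "\<And>n. b n \<noteq> 0"
    and unit: "\<And>n. norm (s n) = 1" "\<And>n. norm (u n) = 1"
    and d: "d > 0" "\<And>n. norm (det2 (s n) (u n)) \<ge> d"
    and p: "\<And>n. norm (p n) \<le> \<kappa>" and q: "\<And>n. norm (q n) \<le> \<epsilon>" and r: "\<And>n. norm (r n) \<le> \<epsilon>"
    and e: "\<And>n. norm (e n - 1) \<le> \<epsilon>" and \<epsilon>: "0 \<le> \<kappa>" "0 < \<epsilon>" "\<kappa> + 8 * \<epsilon> \<le> 1"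
    and t: "\<And>n. norm (t n) \<le> 1" "\<And>n. t n * (e n - q n * t (Suc n)) = p n * t (Suc n) - r n"
  shows "dominated_direction M (s 0 + t 0 *s u 0)"
proof -
  define B where "B n = (\<Prod>i<n. norm (b i))" for n
  have B: "B n > 0" for n using b by (simp add: B_def prod_pos)
  define x where "x n = (\<Prod>i<n. b i * (p i + q i * t i))" for n
  have slow: "M n *v (s 0 + t 0 *s u 0) = x n *s (s n + t n *s u n)" for n
  proof (induction n)
    case 0
    show ?case by (simp add: M0 x_def)
  next
    case (Suc n)
    have "r n + e n * t n = t (Suc n) * (p n + q n * t n)"
      using t(2)[of n] by (simp add: algebra_simps)
    then have "b n * (r n + e n * t n) = b n * (t (Suc n) * (p n + q n * t n))" by simp
    then have *: "b n * r n + t n * b n * e n = b n * (p n + q n * t n) * t (Suc n)"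
      by (simp add: algebra_simps)
    have "M (Suc n) *v (s 0 + t 0 *s u 0) = H n *v (x n *s (s n + t n *s u n))"
      by (simp add: MS Suc flip: matrix_vector_mul_assoc)
    also have "\<dots> = x n *s (H n *v s n + t n *s (H n *v u n))"
      by (simp add: vector_scalar_commute matrix_vector_right_distrib)
    also have "H n *v s n + t n *s (H n *v u n) = (b n * (p n + q n * t n)) *s s (Suc n)
        + (b n * r n + t n * b n * e n) *s u (Suc n)"
      unfolding Hs Hu by (simp add: vec2_eq_iff algebra_simps)
    also have "\<dots> = (b n * (p n + q n * t n)) *s (s (Suc n) + t (Suc n) *s u (Suc n))"
      unfolding * by (simp add: vec2_eq_iff algebra_simps)
    finally show ?case by (simp add: x_def vector_smult_assoc mult.commute)
  qed
  have upper: "norm (M n *v (s 0 + t 0 *s u 0)) \<le> 2 * (B n * (\<kappa> + \<epsilon>) ^ n)" for n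
  proof -
    have "norm (p i + q i * t i) \<le> \<kappa> + \<epsilon> * 1" for i
      using p q t(1) \<epsilon> by (intro order_trans[OF norm_triangle_ineq] add_mono; (unfold norm_mult, intro mult_mono)?) auto
    then have "norm (x n) \<le> (\<Prod>i<n. norm (b i) * (\<kappa> + \<epsilon>))"
      unfolding x_def prod_norm[symmetric] norm_mult by (intro prod_mono) (auto intro!: mult_left_mono)
    then have "norm (x n) \<le> B n * (\<kappa> + \<epsilon>) ^ n"
      by (simp add: B_def prod.distrib)
    moreover have "norm (s n + t n *s u n) \<le> 2"
      using norm_triangle_ineq[of "s n" "t n *s u n"] unit t(1)[of n] by (simp add: norm_smult_complex)
    ultimately have "norm (x n) * norm (s n + t n *s u n) \<le> (B n * (\<kappa> + \<epsilon>) ^ n) * 2"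
      by (intro mult_mono) (auto intro: order_trans[OF norm_ge_zero])
    then show ?thesis unfolding slow norm_smult_complex by simp
  qed
  have "\<exists>y z. M n *v u 0 = y *s s n + z *s u n \<and> norm y \<le> norm z \<and> B n * (1 - 2 * \<epsilon>) ^ n \<le> norm z" for n
  proof (induction n)
    case 0
    show ?case by (intro exI[of _ 0] exI[of _ 1]) (simp add: M0 B_def)
  next
    case (Suc n)
    then obtain y z where yz: "M n *v u 0 = y *s s n + z *s u n" "norm y \<le> norm z"
      "B n * (1 - 2 * \<epsilon>) ^ n \<le> norm z" by blast
    define y' z' where "y' = p n * y + q n * z" and "z' = r n * y + e n * z"
    have "M (Suc n) *v u 0 = H n *v (y *s s n + z *s u n)"
      by (simp add: MS yz flip: matrix_vector_mul_assoc)
    also have "\<dots> = (b n * y') *s s (Suc n) + (b n * z') *s u (Suc n)"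
      by (simp add: matrix_vector_right_distrib vector_scalar_commute Hs Hu y'_def z'_def vec2_eq_iff algebra_simps)
    finally have eq: "M (Suc n) *v u 0 = (b n * y') *s s (Suc n) + (b n * z') *s u (Suc n)" .
    have "norm y' \<le> \<kappa> * norm z + \<epsilon> * norm z"
      unfolding y'_def using p q yz(2) \<epsilon>
      by (intro order_trans[OF norm_triangle_ineq] add_mono; unfold norm_mult; intro mult_mono) auto
    also have "\<dots> = (\<kappa> + \<epsilon>) * norm z" by (simp add: algebra_simps)
    also have "\<dots> \<le> (1 - 2 * \<epsilon>) * norm z" using \<epsilon> by (intro mult_right_mono) auto
    finally have y': "norm y' \<le> (1 - 2 * \<epsilon>) * norm z" .
    have "norm (z - z') \<le> norm (r n * y) + norm ((e n - 1) * z)"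
      using norm_triangle_ineq[of "r n * y" "(e n - 1) * z"]
      by (simp add: z'_def norm_minus_commute algebra_simps)
    also have "\<dots> \<le> \<epsilon> * norm z + \<epsilon> * norm z"
      using r e yz(2) \<epsilon> by (intro add_mono; unfold norm_mult; intro mult_mono) auto
    finally have z': "(1 - 2 * \<epsilon>) * norm z \<le> norm z'"
      using norm_triangle_ineq2[of z z'] by (simp add: algebra_simps)
    have "B (Suc n) * (1 - 2 * \<epsilon>) ^ Suc n = norm (b n) * ((1 - 2 * \<epsilon>) * (B n * (1 - 2 * \<epsilon>) ^ n))"
      by (simp add: B_def)
    also have "\<dots> \<le> norm (b n) * norm z'"
      using z' yz(3) \<epsilon> by (intro mult_left_mono order_trans[OF _ z']) auto
    finally show ?case
      using eq y' z' by (intro exI[of _ "b n * y'"] exI[of _ "b n * z'"]) (auto simp: norm_mult intro: mult_left_mono)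
  qed
  then have lower: "d / 2 * (B n * (1 - 2 * \<epsilon>) ^ n) \<le> norm (M n *v u 0)" for n
  proof -
    obtain y z where yz: "M n *v u 0 = y *s s n + z *s u n" "B n * (1 - 2 * \<epsilon>) ^ n \<le> norm z"
      using \<open>\<And>n. \<exists>y z. _ n y z\<close> by blast
    have "d * (B n * (1 - 2 * \<epsilon>) ^ n) \<le> norm (det2 (s n) (u n)) * norm z"
      using d yz(2) B[of n] \<epsilon> by (intro mult_mono) auto
    also have "\<dots> = norm (det2 (s n) (M n *v u 0))"
      unfolding yz(1) norm_mult[symmetric] by (simp add: det2_def algebra_simps)
    also have "\<dots> \<le> 2 * norm (M n *v u 0)"
      using norm_det2_le[of "s n" "M n *v u 0"] unit by simp
    finally show ?thesis by simp
  qed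
  have nz: "s 0 + t 0 *s u 0 \<noteq> 0"
  proof
    assume "s 0 + t 0 *s u 0 = 0"
    then have "det2 (s 0 + t 0 *s u 0) (u 0) = 0" by (simp add: det2_def)
    moreover have "det2 (s 0 + t 0 *s u 0) (u 0) = det2 (s 0) (u 0)"
      by (simp add: det2_def algebra_simps)
    ultimately show False using d(2)[of 0] d(1) by simp
  qed
  define \<mu> where "\<mu> = (\<kappa> + \<epsilon>) / (1 - 2 * \<epsilon>)"
  have \<mu>: "0 \<le> \<mu>" "\<mu> < 1" using \<epsilon> by (auto simp: \<mu>_def divide_simps)
  have "(\<lambda>n. norm (M n *v (s 0 + t 0 *s u 0)) / norm (M n *v u 0)) \<longlonglongrightarrow> 0"
  proof (rule tendsto_sandwich[OF _ _ tendsto_const])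
    show "\<forall>\<^sub>F n in sequentially. norm (M n *v (s 0 + t 0 *s u 0)) / norm (M n *v u 0) \<le> 4 / d * \<mu> ^ n"
    proof (rule always_eventually, rule allI)
      fix n
      have "norm (M n *v (s 0 + t 0 *s u 0)) / norm (M n *v u 0)
          \<le> (2 * (B n * (\<kappa> + \<epsilon>) ^ n)) / (d / 2 * (B n * (1 - 2 * \<epsilon>) ^ n))"
        using upper lower B[of n] d \<epsilon> by (intro frac_le) auto
      also have "\<dots> = 4 / d * \<mu> ^ n" using B[of n] d by (simp add: \<mu>_def power_divide)
      finally show "norm (M n *v (s 0 + t 0 *s u 0)) / norm (M n *v u 0) \<le> 4 / d * \<mu> ^ n" .
    qed
    show "(\<lambda>n. 4 / d * \<mu> ^ n) \<longlonglongrightarrow> 0"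
      using \<mu> by (intro tendsto_mult_right_zero LIMSEQ_realpow_zero) auto
  qed auto
  moreover have "u 0 \<noteq> 0" using unit(2)[of 0] by auto
  ultimately show ?thesis unfolding dominated_direction_def using nz by blast
qed

text \<open>Here \<open>y\<close> is a point whose orbit carries an invariant dominated frame, and \<open>H n w\<close> is the
  transition matrix at the \<open>n\<close>-th point of the orbit of a nearby \<open>w\<close>.\<close>

lemma holomorphic_dominated_direction:
  fixes H :: "nat \<Rightarrow> complex^2 \<Rightarrow> complex^2^2" and M :: "nat \<Rightarrow> complex^2 \<Rightarrow> complex^2^2"
    and s u :: "nat \<Rightarrow> complex^2" and a b :: "nat \<Rightarrow> complex"
  assumes S: "open S" and M0: "\<And>w. M 0 w = mat 1" and MS: "\<And>n w. M (Suc n) w = H n w ** M n w"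
    and hol: "\<And>n i k. holomorphic2_on (\<lambda>w. H n w $ i $ k) S"
    and unit: "\<And>n. norm (s n) = 1" "\<And>n. norm (u n) = 1"
    and d: "d > 0" "\<And>n. norm (det2 (s n) (u n)) \<ge> d"
    and Hs: "\<And>n. H n y *v s n = a n *s s (Suc n)" and Hu: "\<And>n. H n y *v u n = b n *s u (Suc n)"
    and m: "m > 0" "\<And>n. norm (b n) \<ge> m"
    and dom: "\<And>n. norm (a n) \<le> \<kappa> * norm (b n)"
    and near: "\<And>n w i k. w \<in> S \<Longrightarrow> norm (H n w $ i $ k - H n y $ i $ k) \<le> \<eta>"
    and \<eta>: "8 * \<eta> \<le> \<epsilon> * d * m" and \<epsilon>: "0 \<le> \<kappa>" "0 < \<epsilon>" "\<kappa> + 9 * \<epsilon> \<le> 1"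
  shows "\<exists>v. (\<forall>i. holomorphic2_on (\<lambda>w. v w $ i) S) \<and> (\<forall>w\<in>S. dominated_direction (\<lambda>n. M n w) (v w))"
proof -
  \<comment> \<open>The frame at time \<open>n + 1\<close> receives \<open>H n\<close>, hence the shifted index: the factor \<open>b n\<close> in
    \<open>D (Suc n)\<close> makes the lower right entry of the normalised transition matrix equal to \<open>1\<close> at \<open>y\<close>.\<close>
  define D where "D n = det2 (s n) (u n) * b (n - 1)" for n
  have b0: "b n \<noteq> 0" for n using m(1) m(2)[of n] by auto
  have D0: "D n \<noteq> 0" for n
    using d(1) d(2)[of n] b0 by (auto simp: D_def)
  have Dge: "norm (D n) \<ge> d * m" for n
    unfolding D_def norm_mult using d m by (intro mult_mono) auto
  define p q r e where
    "p n w = det2 (H n w *v s n) (u (Suc n)) / D (Suc n)" and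
    "q n w = det2 (H n w *v u n) (u (Suc n)) / D (Suc n)" and
    "r n w = det2 (s (Suc n)) (H n w *v s n) / D (Suc n)" and
    "e n w = det2 (s (Suc n)) (H n w *v u n) / D (Suc n)" for n w
  have expand: "x = b n *s ((det2 x (u (Suc n)) / D (Suc n)) *s s (Suc n)
      + (det2 (s (Suc n)) x / D (Suc n)) *s u (Suc n))" for x n
  proof -
    have "x = (1 / det2 (s (Suc n)) (u (Suc n))) *s (det2 (s (Suc n)) (u (Suc n)) *s x)"
      using D0[of "Suc n"] by (simp add: vector_smult_assoc D_def)
    then show ?thesis
      unfolding det2_expand[of "s (Suc n)" "u (Suc n)" x] using b0[of n]
      by (simp add: D_def vec2_eq_iff algebra_simps)
  qed
  have at_y: "p n y = a n / b n" "q n y = 0" "r n y = 0" "e n y = 1" for n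
  proof -
    have "det2 (c *s x) z = c * det2 x z" "det2 x (c *s z) = c * det2 x z" "det2 x x = 0" for c x z
      by (auto simp: det2_def algebra_simps)
    then show "p n y = a n / b n" "q n y = 0" "r n y = 0" "e n y = 1"
      using D0[of "Suc n"] by (auto simp: p_def q_def r_def e_def Hs Hu D_def)
  qed
  have diff: "norm ((H n w *v x) $ i - (H n y *v x) $ i) \<le> 2 * \<eta>" if "w \<in> S" "norm x = 1" for n w x i
  proof -
    have "norm ((H n w $ i $ k - H n y $ i $ k) * x $ k) \<le> \<eta> * 1" for k
      unfolding norm_mult using near[OF that(1), of n i k] Finite_Cartesian_Product.norm_nth_le[of x k] that(2)
      by (intro mult_mono) (auto intro: order_trans[OF norm_ge_zero])
    from order_trans[OF norm_triangle_ineq add_mono[OF this this], of 1 2] show ?thesis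
      unfolding matrix_vector_mult_2 by (simp add: algebra_simps)
  qed
  have det_diff: "norm (det2 z (H n w *v x) / D k - det2 z (H n y *v x) / D k) \<le> \<epsilon>"
    "norm (det2 (H n w *v x) z / D k - det2 (H n y *v x) z / D k) \<le> \<epsilon>"
    if w: "w \<in> S" and x: "norm x = 1" and z: "norm z = 1" for n w x z k
  proof -
    have "norm (H n w *v x - H n y *v x) \<le> 2 * \<eta> + 2 * \<eta>"
      using norm_vec2_le[of "H n w *v x - H n y *v x"] diff[OF w x, of n 1] diff[OF w x, of n 2] by simp
    then have "norm (det2 z (H n w *v x - H n y *v x)) \<le> \<epsilon> * (d * m)"
      "norm (det2 (H n w *v x - H n y *v x) z) \<le> \<epsilon> * (d * m)"
      using norm_det2_le[of z "H n w *v x - H n y *v x"] norm_det2_le[of "H n w *v x - H n y *v x" z] z \<eta>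
      by auto
    moreover have "\<epsilon> * (d * m) \<le> \<epsilon> * norm (D k)" using Dge \<epsilon> by (intro mult_left_mono) auto
    ultimately have "norm (det2 z (H n w *v x - H n y *v x)) \<le> \<epsilon> * norm (D k)"
      "norm (det2 (H n w *v x - H n y *v x) z) \<le> \<epsilon> * norm (D k)" by linarith+
    moreover have "det2 z (H n w *v x) - det2 z (H n y *v x) = det2 z (H n w *v x - H n y *v x)"
      "det2 (H n w *v x) z - det2 (H n y *v x) z = det2 (H n w *v x - H n y *v x) z"
      by (auto simp: det2_def algebra_simps)
    ultimately show "norm (det2 z (H n w *v x) / D k - det2 z (H n y *v x) / D k) \<le> \<epsilon>"
      "norm (det2 (H n w *v x) z / D k - det2 (H n y *v x) z / D k) \<le> \<epsilon>"
      unfolding diff_divide_distrib[symmetric] norm_divide using D0[of k] by (auto simp: pos_divide_le_eq)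
  qed
  have p: "norm (p n w) \<le> \<kappa> + \<epsilon>" if "w \<in> S" for n w
  proof -
    have "norm (p n w - p n y) \<le> \<epsilon>" unfolding p_def using det_diff(2)[OF that unit(1) unit(2)] .
    moreover have "norm (p n y) \<le> \<kappa>" unfolding at_y norm_divide using dom[of n] b0[of n] by (simp add: pos_divide_le_eq)
    ultimately show ?thesis using norm_triangle_sub[of "p n w" "p n y"] by linarith
  qed
  have q: "norm (q n w) \<le> \<epsilon>" if "w \<in> S" for n w
    using det_diff(2)[OF that unit(2) unit(2), of n n "Suc n" "Suc n"] at_y(2)[of n] unfolding q_def by simp
  have r: "norm (r n w) \<le> \<epsilon>" if "w \<in> S" for n w
    using det_diff(1)[OF that unit(1) unit(1), of "Suc n" n n "Suc n"] at_y(3)[of n] unfolding r_def by simp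
  have e: "norm (e n w - 1) \<le> \<epsilon>" if "w \<in> S" for n w
    using det_diff(1)[OF that unit(2) unit(1), of "Suc n" n n "Suc n"] at_y(4)[of n] unfolding e_def by simp
  have holHv: "holomorphic2_on (\<lambda>w. (H n w *v x) $ i) S" for n x i
    unfolding matrix_vector_mult_2 by (intro holomorphic2_on_add holomorphic2_on_mult hol holomorphic2_on_const)
  have holp: "holomorphic2_on (p n) S" "holomorphic2_on (q n) S" "holomorphic2_on (r n) S" "holomorphic2_on (e n) S" for n
    unfolding p_def q_def r_def e_def det2_def
    by (intro holomorphic2_on_divide holomorphic2_on_diff holomorphic2_on_mult holHv holomorphic2_on_const D0)+
  have "\<exists>t. (\<forall>n. holomorphic2_on (t n) S) \<and> (\<forall>n. \<forall>w\<in>S. norm (t n w) \<le> 1 \<and>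
    t n w * (e n w - q n w * t (Suc n) w) = p n w * t (Suc n) w - r n w)"
    by (rule invariant_slopes[OF S holp p q r e _ \<epsilon>(2)]) (use \<epsilon> in auto)
  then obtain t where t: "\<forall>n. holomorphic2_on (t n) S" and
    t_inv: "\<forall>n. \<forall>w\<in>S. norm (t n w) \<le> 1 \<and>
      t n w * (e n w - q n w * t (Suc n) w) = p n w * t (Suc n) w - r n w"
    by (elim exE conjE)
  show ?thesis
  proof (intro exI[of _ "\<lambda>w. s 0 + t 0 w *s u 0"] conjI allI ballI)
    show "holomorphic2_on (\<lambda>w. (s 0 + t 0 w *s u 0) $ i) S" for i
      by (simp, intro holomorphic2_on_add holomorphic2_on_mult holomorphic2_on_const t[rule_format])
  next
    fix w assume w: "w \<in> S"
    show "dominated_direction (\<lambda>n. M n w) (s 0 + t 0 w *s u 0)"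
    proof (rule dominated_direction_frames[where H = "\<lambda>n. H n w" and t = "\<lambda>n. t n w" and p = "\<lambda>n. p n w"
          and q = "\<lambda>n. q n w" and r = "\<lambda>n. r n w" and e = "\<lambda>n. e n w" and b = b and u = u and s = s,
          OF M0 MS _ _ b0 unit d p[OF w] q[OF w] r[OF w] e[OF w] _ \<epsilon>(2)])
      show "H n w *v s n = b n *s (p n w *s s (Suc n) + r n w *s u (Suc n))" for n
        unfolding p_def r_def by (rule expand)
      show "H n w *v u n = b n *s (q n w *s s (Suc n) + e n w *s u (Suc n))" for n
        unfolding q_def e_def by (rule expand)
    qed (use \<epsilon> t_inv w in auto)
  qed
qed

section \<open>Bounded holomorphic matrices on a strip\<close>

text \<open>Unlike the unspecified neighbourhoods on which the data are holomorphic, open strips are invariant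
  under real translations.\<close>

definition ostrip :: "real \<Rightarrow> (complex^2) set"
  where "ostrip \<delta> = {w. \<forall>i. \<bar>Im (w $ i)\<bar> < \<delta>}"

lemma ostrip_mono: "\<delta> \<le> \<delta>' \<Longrightarrow> ostrip \<delta> \<subseteq> ostrip \<delta>'"
  unfolding ostrip_def by (blast intro: less_le_trans)

lemma open_ostrip: "open (ostrip \<delta>)"
proof -
  have "ostrip \<delta> = {w. \<bar>Im (w $ 1)\<bar> < \<delta>} \<inter> {w. \<bar>Im (w $ 2)\<bar> < \<delta>}"
    by (auto simp: ostrip_def forall_2)
  then show ?thesis
    by (auto intro!: open_Int open_Collect_less continuous_intros)
qed

lemma convex_ostrip: "convex (ostrip \<delta>)"
proof (rule convexI)
  fix x y :: "complex^2" and a b :: real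
  assume "x \<in> ostrip \<delta>" "y \<in> ostrip \<delta>" and ab: "0 \<le> a" "0 \<le> b" "a + b = 1"
  then have xy: "\<bar>Im (x $ i)\<bar> < \<delta>" "\<bar>Im (y $ i)\<bar> < \<delta>" for i by (auto simp: ostrip_def)
  have "\<bar>a * Im (x $ i) + b * Im (y $ i)\<bar> < \<delta>" for i
  proof -
    have "Im (x $ i) \<in> {-\<delta><..<\<delta>}" "Im (y $ i) \<in> {-\<delta><..<\<delta>}" using xy[of i] by auto
    then have "a *\<^sub>R Im (x $ i) + b *\<^sub>R Im (y $ i) \<in> {-\<delta><..<\<delta>}"
      using ab by (intro convexD[OF convex_real_interval(8)])
    then show ?thesis by auto
  qed
  then show "a *\<^sub>R x + b *\<^sub>R y \<in> ostrip \<delta>" by (simp add: ostrip_def)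
qed

lemma cball_subset_ostrip:
  assumes "w \<in> ostrip \<delta>" "\<delta> + \<rho> \<le> \<delta>'"
  shows "cball w \<rho> \<subseteq> ostrip \<delta>'"
proof
  fix z assume "z \<in> cball w \<rho>"
  then have "norm ((z - w) $ i) \<le> \<rho>" for i
    using Finite_Cartesian_Product.norm_nth_le[of "z - w" i] by (simp add: dist_norm norm_minus_commute)
  then have "\<bar>Im ((z - w) $ i)\<bar> \<le> \<rho>" for i using abs_Im_le_cmod order_trans by blast
  moreover have "\<bar>Im (w $ i)\<bar> < \<delta>" for i using assms by (simp add: ostrip_def)
  ultimately have "\<bar>Im (z $ i)\<bar> < \<delta> + \<rho>" for i
    using abs_triangle_ineq[of "Im (w $ i)" "Im ((z - w) $ i)"] by (simp add: add_less_le_mono order_le_less_trans)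
  then show "z \<in> ostrip \<delta>'" using assms(2) by (auto simp: ostrip_def intro: less_le_trans)
qed

lemma strip_subset_ostrip: "\<delta> < \<delta>' \<Longrightarrow> strip \<delta> \<subseteq> ostrip \<delta>'"
  by (auto simp: strip_def ostrip_def intro: le_less_trans)

lemma complex_vec_add: "complex_vec (x + y) = complex_vec x + complex_vec y"
  and complex_vec_scaleR: "complex_vec (r *\<^sub>R x) = r *\<^sub>R complex_vec x"
  and complex_vec_axis: "complex_vec (axis j 1) = axis j 1"
  by (auto simp: complex_vec_def vec_eq_iff axis_def scaleR_conv_of_real[where 'a = complex])

lemma complex_vec_in_ostrip: "\<delta> > 0 \<Longrightarrow> complex_vec x \<in> ostrip \<delta>"
  by (simp add: ostrip_def complex_vec_def)

lemma ostrip_real_shift: "w \<in> ostrip \<delta> \<Longrightarrow> w + complex_vec t \<in> ostrip \<delta>"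
  by (simp add: ostrip_def complex_vec_def)

lemma norm_diff_complex_vec_Re:
  assumes "w \<in> ostrip \<delta>"
  shows "norm (w - complex_vec (\<chi> i. Re (w $ i))) < 2 * \<delta>"
proof -
  have "(w - complex_vec (\<chi> i. Re (w $ i))) $ i = \<i> * of_real (Im (w $ i))" for i
    by (simp add: complex_vec_def complex_eq_iff)
  then have "norm ((w - complex_vec (\<chi> i. Re (w $ i))) $ i) < \<delta>" for i
    using assms by (simp add: ostrip_def norm_mult)
  from add_strict_mono[OF this[of 1] this[of 2]] norm_vec2_le show ?thesis
    by (metis (no_types, lifting) mult_2 order_le_less_trans)
qed

lemma funpow_shift: "(shift t ^^ n) w = w + real n *\<^sub>R t" for t :: "'a::real_vector"
  by (induction n) (auto simp: shift_def algebra_simps)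

text \<open>The point \<open>x + i y\<close> lies on the complex line \<open>z \<mapsto> x + z y\<close>, whose real points are real
  vectors; so the one-variable identity theorem suffices.\<close>

lemma holomorphic2_eq_zero:
  assumes f: "holomorphic2_on f (ostrip \<delta>)" and 0: "\<And>x. f (complex_vec x) = 0" and w: "w \<in> ostrip \<delta>"
  shows "f w = 0"
proof -
  define x y :: "real^2" where "x = (\<chi> i. Re (w $ i))" and "y = (\<chi> i. Im (w $ i))"
  have w_eq: "w = complex_vec x + \<i> *s complex_vec y"
    by (simp add: vec_eq_iff x_def y_def complex_vec_def complex_eq_iff)
  define m where "m = max \<bar>y $ 1\<bar> \<bar>y $ 2\<bar>"
  have "\<bar>y $ i\<bar> < \<delta>" for i using w by (simp add: y_def ostrip_def)
  then have m: "m < \<delta>" "0 \<le> m" by (auto simp: m_def)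
  have ym: "\<bar>y $ i\<bar> \<le> m" for i using exhaust_2[of i] by (auto simp: m_def)
  \<comment> \<open>Any \<open>c\<close> strictly between \<open>1\<close> and \<open>\<delta> / m\<close> would do; this one is also defined for \<open>m = 0\<close>.\<close>
  define c where "c = 2 * \<delta> / (\<delta> + m)"
  have c: "c > 1" "c * m < \<delta>"
    using m by (auto simp: c_def divide_simps mult_strict_left_mono)
  define g where "g z = f (complex_vec x + z *s complex_vec y)" for z
  have hol: "g holomorphic_on ball 0 c"
    unfolding g_def
  proof (rule slice_holomorphic_on[OF f open_ostrip])
    fix z :: complex assume "z \<in> ball 0 c"
    then have "\<bar>Im z\<bar> \<le> c" using abs_Im_le_cmod[of z] by simp
    then have "\<bar>Im z * y $ i\<bar> \<le> c * m" for i unfolding abs_mult using ym c by (intro mult_mono) auto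
    then show "complex_vec x + z *s complex_vec y \<in> ostrip \<delta>"
      using c by (auto simp: ostrip_def complex_vec_def intro: le_less_trans)
  qed
  have zero: "g z = 0" if z: "z \<in> \<real> \<inter> ball 0 c" for z
  proof -
    obtain r where r: "z = of_real r" using z by (auto elim: Reals_cases)
    have "complex_vec x + z *s complex_vec y = complex_vec (x + r *\<^sub>R y)"
      by (simp add: r vec_eq_iff complex_vec_def)
    then show ?thesis using 0 by (simp add: g_def)
  qed
  have lim: "(0::complex) islimpt (\<real> \<inter> ball 0 c)"
    unfolding islimpt_approachable
  proof (intro allI impI)
    fix e :: real assume "e > 0"
    then show "\<exists>z\<in>\<real> \<inter> ball 0 c. z \<noteq> (0::complex) \<and> dist z 0 < e"
      using c(1) by (intro bexI[of _ "of_real (min e 1 / 2)"])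
        (simp_all add: norm_divide min_def del: of_real_divide)
  qed
  have "\<i> \<in> ball 0 c" "0 \<in> ball (0::complex) c" using c by simp_all
  then have "g \<i> = 0"
    using analytic_continuation[OF hol open_ball connected_ball _ _ lim zero] by blast
  then show ?thesis using w_eq by (simp add: g_def)
qed

definition bounded_holomorphic_matrix :: "real \<Rightarrow> real \<Rightarrow> (complex^2 \<Rightarrow> complex^2^2) \<Rightarrow> bool"
  where "bounded_holomorphic_matrix \<delta> K F \<longleftrightarrow>
    (\<forall>i k. holomorphic2_on (\<lambda>w. F w $ i $ k) (ostrip \<delta>)) \<and>
    (\<forall>w\<in>ostrip \<delta>. \<forall>i k. norm (F w $ i $ k) \<le> K)"

lemma bounded_holomorphic_matrixD:
  assumes "bounded_holomorphic_matrix \<delta> K F"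
  shows "holomorphic2_on (\<lambda>w. F w $ i $ k) (ostrip \<delta>)"
    and "w \<in> ostrip \<delta> \<Longrightarrow> norm (F w $ i $ k) \<le> K"
  using assms by (auto simp: bounded_holomorphic_matrix_def)

lemma bounded_holomorphic_matrix_pos:
  assumes "bounded_holomorphic_matrix \<delta> K F" "w \<in> ostrip \<delta>" "det (F w) \<noteq> 0"
  shows "K > 0"
proof -
  have "norm (det (F w)) * norm (axis 1 1 :: complex^2) \<le> 4 * K * norm (F w *v axis 1 1)"
    using bounded_holomorphic_matrixD(2)[OF assms(1,2)] by (intro norm_matrix_vector_ge)
  moreover have "norm (det (F w)) * norm (axis 1 1 :: complex^2) > 0"
    using assms(3) by (simp add: axis_eq_0_iff)
  ultimately have "0 < 4 * K * norm (F w *v axis 1 1)" by linarith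
  then show ?thesis by (simp add: zero_less_mult_iff)
qed

lemma strip_extension_bounded_holomorphic:
  assumes "strip_extension \<delta> F F'"
  shows "\<exists>K. bounded_holomorphic_matrix \<delta> K F'"
proof -
  obtain V where V: "strip \<delta> \<subseteq> V" "matrix_holomorphic_on F' V"
    and "bounded (F' ` strip \<delta>)" using assms unfolding strip_extension_def by blast
  then obtain K where K: "\<And>w. w \<in> strip \<delta> \<Longrightarrow> norm (F' w) \<le> K"
    unfolding bounded_iff by blast
  have sub: "ostrip \<delta> \<subseteq> strip \<delta>" by (auto simp: ostrip_def strip_def intro: less_imp_le)
  have "norm (F' w $ i $ k) \<le> K" if "w \<in> ostrip \<delta>" for w i k
  proof -
    have "norm (F' w $ i $ k) \<le> norm (F' w $ i)" by (rule Finite_Cartesian_Product.norm_nth_le)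
    also have "\<dots> \<le> norm (F' w)" by (rule Finite_Cartesian_Product.norm_nth_le)
    also have "\<dots> \<le> K" using K sub that by blast
    finally show ?thesis .
  qed
  then show ?thesis
    using V sub unfolding bounded_holomorphic_matrix_def matrix_holomorphic_on_def
    by (meson holomorphic2_on_subset subset_trans)
qed

lemma bounded_holomorphic_matrix_mult:
  assumes F: "bounded_holomorphic_matrix \<delta> K F" and G: "bounded_holomorphic_matrix \<delta> L G"
  shows "bounded_holomorphic_matrix \<delta> (2 * K * L) (\<lambda>w. F w ** G w)"
  unfolding bounded_holomorphic_matrix_def matrix_matrix_mult_2
proof (intro conjI allI ballI)
  show "holomorphic2_on (\<lambda>w. F w $ i $ 1 * G w $ 1 $ k + F w $ i $ 2 * G w $ 2 $ k) (ostrip \<delta>)" for i k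
    by (intro holomorphic2_on_add holomorphic2_on_mult bounded_holomorphic_matrixD(1)[OF F]
        bounded_holomorphic_matrixD(1)[OF G])
  fix w i k assume w: "w \<in> ostrip \<delta>"
  have "norm (F w $ i $ j * G w $ j $ k) \<le> K * L" for j
    unfolding norm_mult
    by (rule mult_mono[OF bounded_holomorphic_matrixD(2)[OF F w] bounded_holomorphic_matrixD(2)[OF G w]
          order_trans[OF norm_ge_zero bounded_holomorphic_matrixD(2)[OF F w]] norm_ge_zero])
  from order_trans[OF norm_triangle_ineq add_mono[OF this this]]
  show "norm (F w $ i $ 1 * G w $ 1 $ k + F w $ i $ 2 * G w $ 2 $ k) \<le> 2 * K * L" by (simp add: mult.assoc)
qed

lemma bounded_holomorphic_matrix_shift:
  assumes F: "bounded_holomorphic_matrix \<delta> K F"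
  shows "bounded_holomorphic_matrix \<delta> K (\<lambda>w. F (w + complex_vec t))"
  using F ostrip_real_shift unfolding bounded_holomorphic_matrix_def
  by (auto intro!: holomorphic2_on_translate[where T = "ostrip \<delta>" and f = "\<lambda>w. F w $ _ $ _"])

lemma bounded_holomorphic_cocycle_iterate:
  assumes "bounded_holomorphic_matrix \<delta> K A"
  shows "\<exists>L. bounded_holomorphic_matrix \<delta> L (cocycle_iterate (complex_vec \<tau>) A n)"
proof (induction n)
  case 0
  show ?case
    by (intro exI[of _ 1]) (auto simp: bounded_holomorphic_matrix_def mat_def)
next
  case (Suc n)
  then obtain L where L: "bounded_holomorphic_matrix \<delta> L (cocycle_iterate (complex_vec \<tau>) A n)" by blast
  have "(shift (complex_vec \<tau>) ^^ n) w = w + complex_vec (real n *\<^sub>R \<tau>)" for w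
    by (simp add: funpow_shift complex_vec_scaleR)
  then have "cocycle_iterate (complex_vec \<tau>) A (Suc n) =
      (\<lambda>w. A (w + complex_vec (real n *\<^sub>R \<tau>)) ** cocycle_iterate (complex_vec \<tau>) A n w)"
    by auto
  then show ?case
    using bounded_holomorphic_matrix_mult[OF bounded_holomorphic_matrix_shift[OF assms] L] by auto
qed

lemma bounded_holomorphic_matrix_Lipschitz:
  assumes F: "bounded_holomorphic_matrix \<delta> K F" and \<delta>: "\<delta> > 0"
    and xy: "x \<in> ostrip (\<delta> / 2)" "y \<in> ostrip (\<delta> / 2)"
  shows "norm (F x $ i $ k - F y $ i $ k) \<le> 2 * K / \<delta> * norm (x - y)"
proof -
  have "norm (F x $ i $ k - F y $ i $ k) \<le> K / (\<delta> / 2) * norm (x - y)"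
  proof (rule holomorphic2_on_Lipschitz[OF bounded_holomorphic_matrixD(1)[OF F] open_ostrip
        convex_ostrip cball_subset_ostrip _ bounded_holomorphic_matrixD(2)[OF F] xy])
  qed (use \<delta> in auto)
  then show ?thesis by (simp add: mult_ac)
qed

text \<open>The determinant is Lipschitz near the real plane, so the lower bound persists on a thin strip.\<close>

lemma det_bounded_below_near_real:
  assumes F: "bounded_holomorphic_matrix \<delta> K F" and \<delta>: "\<delta> > 0" and c: "c > 0"
    and det: "\<And>x. norm (det (F (complex_vec x))) \<ge> c"
  shows "\<exists>\<delta>'>0. \<delta>' < \<delta> \<and> (\<forall>w\<in>ostrip \<delta>'. norm (det (F w)) \<ge> c / 2)"
proof -
  define L where "L = 4 * K\<^sup>2 / \<delta>"
  have L: "L \<ge> 0" using \<delta> by (simp add: L_def)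
  have Lip: "norm (det (F x) - det (F y)) \<le> L * norm (x - y)"
    if xy: "x \<in> ostrip (\<delta> / 2)" "y \<in> ostrip (\<delta> / 2)" for x y
  proof -
    have "norm (det (F x) - det (F y)) \<le> (2 * K\<^sup>2) / (\<delta> / 2) * norm (x - y)"
    proof (rule holomorphic2_on_Lipschitz[OF _ open_ostrip convex_ostrip cball_subset_ostrip _ _ xy])
      show "holomorphic2_on (\<lambda>x. det (F x)) (ostrip \<delta>)"
        unfolding det_2
        by (intro holomorphic2_on_diff holomorphic2_on_mult bounded_holomorphic_matrixD(1)[OF F])
      fix x assume x: "x \<in> ostrip \<delta>"
      have "norm (F x $ i $ j * F x $ k $ l) \<le> K * K" for i j k l
        unfolding norm_mult
        by (rule mult_mono[OF bounded_holomorphic_matrixD(2)[OF F x] bounded_holomorphic_matrixD(2)[OF F x]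
              order_trans[OF norm_ge_zero bounded_holomorphic_matrixD(2)[OF F x]] norm_ge_zero])
      from order_trans[OF norm_triangle_ineq4 add_mono[OF this this]]
      show "norm (det (F x)) \<le> 2 * K\<^sup>2" unfolding det_2 power2_eq_square by simp
    qed (use \<delta> in auto)
    then show ?thesis by (simp add: L_def)
  qed
  define \<delta>' where "\<delta>' = min (\<delta> / 2) (c / (4 * (L + 1)))"
  have "\<delta>' > 0" using \<delta> c L by (simp add: \<delta>'_def)
  moreover have "\<delta>' \<le> \<delta> / 2" unfolding \<delta>'_def by (rule min.cobounded1)
  ultimately have \<delta>': "\<delta>' > 0" "\<delta>' \<le> \<delta> / 2" .
  have "\<delta>' * (4 * (L + 1)) \<le> c"
  proof -
    have "\<delta>' \<le> c / (4 * (L + 1))" by (simp add: \<delta>'_def)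
    then show ?thesis using L by (simp add: pos_le_divide_eq)
  qed
  moreover have "\<delta>' * (4 * (L + 1)) = 4 * (L * \<delta>') + 4 * \<delta>'" by (simp add: algebra_simps)
  ultimately have L\<delta>': "L * (2 * \<delta>') \<le> c / 2" using \<delta>'(1) by simp
  have "norm (det (F w)) \<ge> c / 2" if w: "w \<in> ostrip \<delta>'" for w
  proof -
    define x where "x = complex_vec (\<chi> i. Re (w $ i))"
    have "w \<in> ostrip (\<delta> / 2)" using w ostrip_mono[OF \<delta>'(2)] by blast
    moreover have "x \<in> ostrip (\<delta> / 2)" unfolding x_def using \<delta> by (intro complex_vec_in_ostrip) simp
    ultimately have "norm (det (F x) - det (F w)) \<le> L * norm (x - w)" using Lip by blast
    also have "\<dots> \<le> L * (2 * \<delta>')"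
      using norm_diff_complex_vec_Re[OF w] L by (intro mult_left_mono) (auto simp: x_def norm_minus_commute)
    finally have "norm (det (F x) - det (F w)) \<le> c / 2" using L\<delta>' by linarith
    then show ?thesis
      using det[of "\<chi> i. Re (w $ i)"] norm_triangle_ineq2[of "det (F x)" "det (F w)"] by (simp add: x_def)
  qed
  moreover have "\<delta>' < \<delta>" using \<delta>' \<delta> by simp
  ultimately show ?thesis using \<delta>' by blast
qed

section \<open>Cocycles over a real translation\<close>

lemma cocycle_iterate_equivariant:
  fixes t e :: "'a::real_vector"
  assumes S: "\<And>w. w \<in> S \<Longrightarrow> w + t \<in> S"
    and eq: "\<And>w. w \<in> S \<Longrightarrow> F (w + e) ** V w = V (w + t) ** F w" and w: "w \<in> S"
  shows "cocycle_iterate t F n (w + e) ** V w = V (w + real n *\<^sub>R t) ** cocycle_iterate t F n w"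
proof (induction n)
  case (Suc n)
  have in_S: "w + real n *\<^sub>R t \<in> S"
  proof (induction n)
    case (Suc n)
    then show ?case using S[OF Suc] by (simp add: algebra_simps)
  qed (simp add: w)
  have "cocycle_iterate t F (Suc n) (w + e) ** V w
      = F ((w + real n *\<^sub>R t) + e) ** (cocycle_iterate t F n (w + e) ** V w)"
    by (simp add: funpow_shift algebra_simps matrix_mul_assoc)
  also have "\<dots> = (F ((w + real n *\<^sub>R t) + e) ** V (w + real n *\<^sub>R t)) ** cocycle_iterate t F n w"
    by (simp add: Suc matrix_mul_assoc)
  also have "\<dots> = V (w + real n *\<^sub>R t + t) ** cocycle_iterate t F (Suc n) w"
    unfolding eq[OF in_S] by (simp add: funpow_shift matrix_mul_assoc)
  finally show ?case by (simp add: algebra_simps)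
qed simp

lemma cocycle_iterate_Suc_right:
  fixes t :: "'a::real_vector"
  shows "cocycle_iterate t F (Suc n) w = cocycle_iterate t F n (w + t) ** F w"
proof (induction n)
  case (Suc n)
  have "cocycle_iterate t F (Suc (Suc n)) w = F (w + real (Suc n) *\<^sub>R t) ** cocycle_iterate t F (Suc n) w"
    by (simp only: cocycle_iterate.simps(2)[of t F "Suc n"] funpow_shift)
  also have "\<dots> = F ((w + t) + real n *\<^sub>R t) ** cocycle_iterate t F n (w + t) ** F w"
    unfolding Suc by (simp add: matrix_mul_assoc algebra_simps)
  finally show ?case by (simp add: funpow_shift)
qed simp

lemma norm_det_cocycle_iterate_ge:
  assumes "c \<ge> 0" "\<And>k. norm (det (F ((shift t ^^ k) w))) \<ge> c"
  shows "norm (det (cocycle_iterate t F n w)) \<ge> c ^ n"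
proof (induction n)
  case (Suc n)
  then show ?case
    using mult_mono[OF assms(2)[of n] Suc] assms(1) by (simp add: det_mul norm_mult)
qed simp

lemma cocycle_iterate_complex_vec:
  assumes "\<And>x. A' (complex_vec x) = A x"
  shows "cocycle_iterate (complex_vec \<tau>) A' n (complex_vec x) = cocycle_iterate \<tau> A n x"
  by (induction n) (auto simp: funpow_shift assms simp flip: complex_vec_add complex_vec_scaleR)

lemma mem_line_funpow:
  assumes inv: "\<And>x. proj_act (F (complex_vec x)) (l x) = l (x + \<sigma>)"
    and det: "\<And>x. det (F (complex_vec x)) \<noteq> 0" and v: "v \<in> Rep_cp1 (l x)" "v \<noteq> 0"
  shows "cocycle_iterate (complex_vec \<sigma>) F n (complex_vec x) *v v \<in> Rep_cp1 (l (x + real n *\<^sub>R \<sigma>)) - {0}"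
proof (induction n)
  case 0
  then show ?case using v by simp
next
  case (Suc n)
  define y where "y = x + real n *\<^sub>R \<sigma>"
  define v' where "v' = cocycle_iterate (complex_vec \<sigma>) F n (complex_vec x) *v v"
  have v': "v' \<in> Rep_cp1 (l y)" "v' \<noteq> 0" using Suc by (auto simp: v'_def y_def)
  have "(shift (complex_vec \<sigma>) ^^ n) (complex_vec x) = complex_vec y"
    by (simp add: funpow_shift complex_vec_add complex_vec_scaleR y_def)
  then have "cocycle_iterate (complex_vec \<sigma>) F (Suc n) (complex_vec x) *v v = F (complex_vec y) *v v'"
    by (simp add: v'_def flip: matrix_vector_mul_assoc)
  moreover have nz: "F (complex_vec y) *v v' \<noteq> 0" using matrix_vector_nonzero[OF det v'(2)] .
  moreover have "l (y + \<sigma>) = line_through (F (complex_vec y) *v v')"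
    unfolding inv[symmetric] cp1_eq_line_through[OF v'] using proj_act_line_through v'(2) by blast
  moreover have "y + \<sigma> = x + real (Suc n) *\<^sub>R \<sigma>" by (simp add: y_def algebra_simps)
  ultimately show ?case using line_through_mem by auto
qed

lemma det_cocycle_iterate_nonzero:
  assumes "\<And>k. det (F ((shift t ^^ k) w)) \<noteq> 0"
  shows "det (cocycle_iterate t F n w) \<noteq> 0"
  by (induction n) (auto simp: det_mul assms)

lemma dominated_direction_real:
  assumes ls: "\<And>x. proj_act (F (complex_vec x)) (ls x) = ls (x + \<sigma>)"
    and lu: "\<And>x. proj_act (F (complex_vec x)) (lu x) = lu (x + \<sigma>)"
    and det: "\<And>x. det (F (complex_vec x)) \<noteq> 0"
    and dom: "\<And>x v u. v \<in> Rep_cp1 (ls x) \<Longrightarrow> u \<in> Rep_cp1 (lu x) \<Longrightarrow>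
      norm (F (complex_vec x) *v v) * norm u \<le> \<kappa> * (norm (F (complex_vec x) *v u) * norm v)"
    and \<kappa>: "0 \<le> \<kappa>" "\<kappa> < 1"
    and v: "v \<in> Rep_cp1 (ls x)" "v \<noteq> 0"
  shows "dominated_direction (\<lambda>n. cocycle_iterate (complex_vec \<sigma>) F n (complex_vec x)) v"
proof -
  obtain u where u: "u \<in> Rep_cp1 (lu x)" "norm u = 1" using obtain_unit_vector .
  then have u0: "u \<noteq> 0" by auto
  define M where "M n = cocycle_iterate (complex_vec \<sigma>) F n (complex_vec x)" for n
  define y where "y n = x + real n *\<^sub>R \<sigma>" for n
  have sh: "(shift (complex_vec \<sigma>) ^^ n) (complex_vec x) = complex_vec (y n)" for n
    by (simp add: funpow_shift complex_vec_add complex_vec_scaleR y_def)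
  have Suc_eq: "M (Suc n) *v z = F (complex_vec (y n)) *v (M n *v z)" for n z
    by (simp add: M_def sh flip: matrix_vector_mul_assoc)
  have mem: "M n *v v \<in> Rep_cp1 (ls (y n))" "M n *v u \<in> Rep_cp1 (lu (y n))" "M n *v u \<noteq> 0" for n
    using mem_line_funpow[of F ls, OF ls det v] mem_line_funpow[of F lu, OF lu det u(1) u0]
    by (auto simp: M_def y_def)
  have le: "norm (M n *v v) \<le> \<kappa> ^ n * norm v * norm (M n *v u)" for n
  proof (induction n)
    case 0
    then show ?case by (simp add: M_def u)
  next
    case (Suc n)
    have "norm (M (Suc n) *v v) * norm (M n *v u) \<le> \<kappa> * (norm (M (Suc n) *v u) * norm (M n *v v))"
      unfolding Suc_eq by (rule dom) (rule mem)+
    also have "\<dots> \<le> \<kappa> * (norm (M (Suc n) *v u) * (\<kappa> ^ n * norm v * norm (M n *v u)))"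
      using Suc \<kappa> by (intro mult_left_mono) auto
    finally have "norm (M (Suc n) *v v) * norm (M n *v u)
        \<le> (\<kappa> ^ Suc n * norm v * norm (M (Suc n) *v u)) * norm (M n *v u)" by (simp add: mult_ac)
    then show ?case using mem(3)[of n] by simp
  qed
  have "(\<lambda>n. norm (M n *v v) / norm (M n *v u)) \<longlonglongrightarrow> 0"
  proof (rule tendsto_sandwich[OF _ _ tendsto_const])
    show "\<forall>\<^sub>F n in sequentially. norm (M n *v v) / norm (M n *v u) \<le> norm v * \<kappa> ^ n"
      using le mem(3) by (intro always_eventually allI) (simp add: pos_divide_le_eq mult_ac)
    show "(\<lambda>n. norm v * \<kappa> ^ n) \<longlonglongrightarrow> 0"
      using \<kappa> by (intro tendsto_mult_right_zero LIMSEQ_realpow_zero) auto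
  qed auto
  then show ?thesis unfolding dominated_direction_def M_def using v u0 by blast
qed

text \<open>Around each real point there is a ball, of a radius independent of the point, on which the
  dominated direction of the complexified cocycle exists and depends holomorphically on the base
  point. The frames are chosen separately at each point of the real orbit, and the Lipschitz
  bound for \<open>F\<close> compares the orbit of a nearby complex point with the real orbit.\<close>

lemma holomorphic_dominated_direction_near_real:
  assumes F: "bounded_holomorphic_matrix \<delta> K F" and \<delta>: "\<delta> > 0"
    and c: "c > 0" "\<And>x. norm (det (F (complex_vec x))) \<ge> c"
    and ls: "\<And>x. proj_act (F (complex_vec x)) (ls x) = ls (x + \<sigma>)"
    and lu: "\<And>x. proj_act (F (complex_vec x)) (lu x) = lu (x + \<sigma>)"
    and d: "d > 0" "\<And>x v u. v \<in> Rep_cp1 (ls x) \<Longrightarrow> norm v = 1 \<Longrightarrow> u \<in> Rep_cp1 (lu x) \<Longrightarrow> norm u = 1 \<Longrightarrow>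
      norm (det2 v u) \<ge> d"
    and dom: "\<And>x v u. v \<in> Rep_cp1 (ls x) \<Longrightarrow> u \<in> Rep_cp1 (lu x) \<Longrightarrow>
      norm (F (complex_vec x) *v v) * norm u \<le> \<kappa> * (norm (F (complex_vec x) *v u) * norm v)"
    and \<kappa>: "0 \<le> \<kappa>" "\<kappa> < 1"
  shows "\<exists>\<rho>>0. \<forall>x. \<exists>v. (\<forall>i. holomorphic2_on (\<lambda>w. v w $ i) (ball (complex_vec x) \<rho>)) \<and>
    (\<forall>w\<in>ball (complex_vec x) \<rho>. dominated_direction (\<lambda>n. cocycle_iterate (complex_vec \<sigma>) F n w) (v w))"
proof -
  have det: "det (F (complex_vec x)) \<noteq> 0" for x using c(1) c(2)[of x] by auto
  have K: "K > 0"
    using bounded_holomorphic_matrix_pos[OF F complex_vec_in_ostrip[OF \<delta>] det] .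
  define m where "m = c / (4 * K)"
  have m: "m > 0" using c K by (simp add: m_def)
  \<comment> \<open>\<open>\<epsilon>\<close> is the tolerance of the graph transform in normalised frames; there a perturbation \<open>\<eta>\<close> of
    the entries of \<open>F\<close> counts as \<open>8 \<eta> / (d m)\<close>.\<close>
  define \<epsilon> where "\<epsilon> = (1 - \<kappa>) / 9"
  have \<epsilon>: "0 < \<epsilon>" "\<kappa> + 9 * \<epsilon> \<le> 1" using \<kappa> by (auto simp: \<epsilon>_def field_simps)
  define L where "L = 2 * K / \<delta>"
  have L: "L > 0" using K \<delta> by (simp add: L_def)
  define \<rho> where "\<rho> = min (\<delta> / 2) (\<epsilon> * d * m / (8 * L))"
  have "\<rho> > 0" using \<delta> \<epsilon> d m L by (simp add: \<rho>_def)
  moreover have "\<rho> \<le> \<delta> / 2" "\<rho> \<le> \<epsilon> * d * m / (8 * L)"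
    unfolding \<rho>_def by (rule min.cobounded1, rule min.cobounded2)
  ultimately have \<rho>: "\<rho> > 0" "\<rho> \<le> \<delta> / 2" "\<rho> \<le> \<epsilon> * d * m / (8 * L)" .
  have \<eta>: "8 * (L * \<rho>) \<le> \<epsilon> * d * m"
    using \<rho>(3) L by (simp add: pos_le_divide_eq mult_ac)
  have "\<exists>v. (\<forall>i. holomorphic2_on (\<lambda>w. v w $ i) (ball (complex_vec x) \<rho>)) \<and>
      (\<forall>w\<in>ball (complex_vec x) \<rho>. dominated_direction (\<lambda>n. cocycle_iterate (complex_vec \<sigma>) F n w) (v w))" for x
  proof -
    define y where "y n = x + real n *\<^sub>R \<sigma>" for n
    have "\<exists>v. v \<in> Rep_cp1 L \<and> norm v = 1" for L using obtain_unit_vector by blast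
    then obtain e where e: "\<And>L. e L \<in> Rep_cp1 L \<and> norm (e L) = 1" by metis
    define s u where "s n = e (ls (y n))" and "u n = e (lu (y n))" for n
    have s: "s n \<in> Rep_cp1 (ls (y n))" "norm (s n) = 1"
      and u: "u n \<in> Rep_cp1 (lu (y n))" "norm (u n) = 1" for n
      using e by (auto simp: s_def u_def)
    define H where "H n w = F ((shift (complex_vec \<sigma>) ^^ n) w)" for n w
    have H: "H n w = F (w + complex_vec (real n *\<^sub>R \<sigma>))" for n w
      by (simp add: H_def funpow_shift complex_vec_scaleR)
    have H_real: "H n (complex_vec x) = F (complex_vec (y n))" for n
      by (simp add: H y_def complex_vec_add)
    have y_Suc: "y (Suc n) = y n + \<sigma>" for n by (simp add: y_def algebra_simps)
    have multiple: "\<exists>a. H n (complex_vec x) *v z = a *s z'"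
      if l: "\<And>x. proj_act (F (complex_vec x)) (l x) = l (x + \<sigma>)"
        and z: "z \<in> Rep_cp1 (l (y n))" "z \<noteq> 0" and z': "z' \<in> Rep_cp1 (l (y (Suc n)))" "z' \<noteq> 0" for l n z z'
    proof -
      have "H n (complex_vec x) *v z \<in> Rep_cp1 (l (y (Suc n)))"
        using mem_line_funpow[of F l \<sigma> z "y n" 1, OF l det z] by (simp add: H_real y_Suc)
      then show ?thesis
        unfolding cp1_eq_line_through[OF z'] Rep_line_through[OF z'(2)] by blast
    qed
    have nz: "s n \<noteq> 0" "u n \<noteq> 0" for n using s(2)[of n] u(2)[of n] by auto
    have "\<forall>n. \<exists>a. H n (complex_vec x) *v s n = a *s s (Suc n)" "\<forall>n. \<exists>a. H n (complex_vec x) *v u n = a *s u (Suc n)"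
      using multiple[of ls, OF ls s(1) nz(1) s(1) nz(1)] multiple[of lu, OF lu u(1) nz(2) u(1) nz(2)] by blast+
    then obtain a b where a: "\<And>n. H n (complex_vec x) *v s n = a n *s s (Suc n)"
      and b: "\<And>n. H n (complex_vec x) *v u n = b n *s u (Suc n)" by metis
    have norm_a: "norm (a n) = norm (F (complex_vec (y n)) *v s n)" for n
      using a[of n] s(2) by (simp add: H_real norm_smult_complex)
    have norm_b: "norm (b n) = norm (F (complex_vec (y n)) *v u n)" for n
      using b[of n] u(2) by (simp add: H_real norm_smult_complex)
    show ?thesis
    proof (rule holomorphic_dominated_direction[where H = H and s = s and u = u and a = a and b = b
          and y = "complex_vec x" and M = "cocycle_iterate (complex_vec \<sigma>) F", OF open_ball _ _ _ s(2) u(2) d(1) _ a b m _ _ _ \<eta> \<kappa>(1) \<epsilon>])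
      show "cocycle_iterate (complex_vec \<sigma>) F 0 w = mat 1" for w by simp
      show "cocycle_iterate (complex_vec \<sigma>) F (Suc n) w = H n w ** cocycle_iterate (complex_vec \<sigma>) F n w" for n w
        by (simp add: H_def)
      show "d \<le> norm (det2 (s n) (u n))" for n using d(2) s u by blast
      show "norm (a n) \<le> \<kappa> * norm (b n)" for n
        unfolding norm_a norm_b using dom[OF s(1) u(1), of n] s(2) u(2) by simp
      show "m \<le> norm (b n)" for n
      proof -
        have "norm (det (F (complex_vec (y n)))) * norm (u n) \<le> 4 * K * norm (F (complex_vec (y n)) *v u n)"
          using bounded_holomorphic_matrixD(2)[OF F complex_vec_in_ostrip[OF \<delta>]] by (intro norm_matrix_vector_ge)
        then have "c \<le> 4 * K * norm (b n)" using c(2)[of "y n"] u(2) by (simp add: norm_b)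
        then show ?thesis using K by (simp add: m_def pos_divide_le_eq mult_ac)
      qed
      have half: "complex_vec x \<in> ostrip (\<delta> / 2)" using \<delta> by (intro complex_vec_in_ostrip) simp
      have in_half: "w \<in> ostrip (\<delta> / 2)" if w: "w \<in> ball (complex_vec x) \<rho>" for w
      proof -
        have "norm ((w - complex_vec x) $ i) < \<delta> / 2" for i
          using w \<rho>(2) Finite_Cartesian_Product.norm_nth_le[of "w - complex_vec x" i]
          by (simp add: dist_norm norm_minus_commute)
        then have "\<bar>Im ((w - complex_vec x) $ i)\<bar> < \<delta> / 2" for i
          using abs_Im_le_cmod order_le_less_trans by blast
        then show ?thesis by (simp add: ostrip_def complex_vec_def)
      qed
      have sub: "ostrip (\<delta> / 2) \<subseteq> ostrip \<delta>" using \<delta> by (intro ostrip_mono) simp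
      show "holomorphic2_on (\<lambda>w. H n w $ i $ k) (ball (complex_vec x) \<rho>)" for n i k
        unfolding H
        by (rule holomorphic2_on_translate[OF bounded_holomorphic_matrixD(1)[OF F]])
          (use in_half sub ostrip_real_shift in blast)
      show "norm (H n w $ i $ k - H n (complex_vec x) $ i $ k) \<le> L * \<rho>" if w: "w \<in> ball (complex_vec x) \<rho>" for n w i k
      proof -
        have "norm (H n w $ i $ k - H n (complex_vec x) $ i $ k) \<le> L * norm (w - complex_vec x)"
          using bounded_holomorphic_matrix_Lipschitz[OF F \<delta> ostrip_real_shift[where t = "real n *\<^sub>R \<sigma>", OF in_half[OF w]]
              ostrip_real_shift[where t = "real n *\<^sub>R \<sigma>", OF half]]
          unfolding H L_def by simp
        also have "\<dots> \<le> L * \<rho>"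
          using w L by (intro mult_left_mono) (auto simp: dist_norm norm_minus_commute)
        finally show ?thesis .
      qed
    qed
  qed
  then show ?thesis using \<rho>(1) by blast
qed

section \<open>Uniform bounds from periodicity\<close>

text \<open>The unit square is compact and contains a translate of every point.\<close>

lemma periodic_bounded_below:
  fixes f :: "real^2 \<Rightarrow> real"
  assumes cont: "continuous_on UNIV f" and per: "\<And>j w. f (w + axis j 1) = f w" and pos: "\<And>w. f w > 0"
  shows "\<exists>c>0. \<forall>w. f w \<ge> c"
proof -
  have nat_per: "f (w + real n *\<^sub>R axis j 1) = f w" for w n j
  proof (induction n)
    case (Suc n)
    then show ?case using per[of "w + real n *\<^sub>R axis j 1" j] by (simp add: algebra_simps)
  qed simp
  have int_per: "f (w + of_int k *\<^sub>R axis j 1) = f w" for w k j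
  proof (cases "k \<ge> 0")
    case True
    then show ?thesis using nat_per[of w "nat k" j] by simp
  next
    case False
    then show ?thesis using nat_per[of "w + of_int k *\<^sub>R axis j 1" "nat (- k)" j] by simp
  qed
  obtain x0 where x0: "\<And>x. x \<in> cbox 0 1 \<Longrightarrow> f x0 \<le> f x"
  proof -
    have "\<exists>x\<in>cbox 0 (1::real^2). \<forall>y\<in>cbox 0 1. f x \<le> f y"
    proof (rule continuous_attains_inf)
      show "cbox 0 (1::real^2) \<noteq> {}"
        by (simp add: interval_ne_empty_cart)
      show "continuous_on (cbox 0 1) f" using cont continuous_on_subset by blast
    qed (rule compact_cbox)
    then show thesis using that by blast
  qed
  have "f w \<ge> f x0" for w
  proof -
    define w' where "w' = (\<chi> i. frac (w $ i))"
    have "w' \<in> cbox 0 1" by (auto simp: w'_def mem_box_cart frac_lt_1 less_imp_le)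
    moreover have "w = (w' + of_int \<lfloor>w $ 1\<rfloor> *\<^sub>R axis 1 1) + of_int \<lfloor>w $ 2\<rfloor> *\<^sub>R axis 2 1"
      by (simp add: vec2_eq_iff w'_def axis_def frac_def)
    then have "f w = f w'" using int_per by metis
    ultimately show ?thesis using x0 by simp
  qed
  then show ?thesis using pos by blast
qed

text \<open>The angle between the two lines is bounded below: it is continuous and positive, and it is
  periodic because the sewing maps are unitary.\<close>

lemma dominated_splitting_angle:
  assumes U: "unitary_sewing_system U"
    and ls: "invariant_line \<tau> U A ls" and lu: "invariant_line \<tau> U A lu" and ne: "\<And>w. ls w \<noteq> lu w"
  shows "\<exists>d>0. \<forall>x v u. v \<in> Rep_cp1 (ls x) \<longrightarrow> norm v = 1 \<longrightarrow> u \<in> Rep_cp1 (lu x) \<longrightarrow> norm u = 1 \<longrightarrow>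
    norm (det2 v u) \<ge> d"
proof -
  define f where "f x = Re (sin_angle_sq (ls x) (lu x))" for x
  have f_eq: "f x = (norm (det2 v u))\<^sup>2"
    if "v \<in> Rep_cp1 (ls x)" "norm v = 1" "u \<in> Rep_cp1 (lu x)" "norm u = 1" for x v u
    unfolding f_def sin_angle_sq_eq[OF that] by simp
  have "\<exists>c>0. \<forall>x. f x \<ge> c"
  proof (rule periodic_bounded_below)
    have "continuous_on UNIV (\<lambda>x. line_proj i k (ls x))" "continuous_on UNIV (\<lambda>x. line_proj i k (lu x))" for i k
      using ls lu unfolding invariant_line_def
      by (auto intro: continuous_on_compose2[OF continuous_on_line_proj])
    then show "continuous_on UNIV f"
      unfolding f_def sin_angle_sq_def by (intro continuous_intros)
  next
    fix j w
    obtain v u where v: "v \<in> Rep_cp1 (ls w)" "norm v = 1" and u: "u \<in> Rep_cp1 (lu w)" "norm u = 1"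
      using obtain_unit_vector by metis
    have uni: "unitary (U j w)" using U by (simp add: unitary_sewing_system_def)
    have mem: "U j w *v z \<in> Rep_cp1 (l (w + axis j 1)) \<and> norm (U j w *v z) = 1"
      if l: "invariant_line \<tau> U A l" and z: "z \<in> Rep_cp1 (l w)" "norm z = 1" for l z
    proof -
      have z0: "z \<noteq> 0" using z by auto
      have n1: "norm (U j w *v z) = 1" using unitary_isometry(1)[OF uni] z by simp
      then have "U j w *v z \<noteq> 0" by auto
      moreover have "l (w + axis j 1) = line_through (U j w *v z)"
        using l cp1_eq_line_through[OF z(1) z0] proj_act_line_through[OF z0]
        by (simp add: invariant_line_def)
      ultimately show ?thesis using line_through_mem n1 by simp
    qed
    have "f (w + axis j 1) = (norm (det2 (U j w *v v) (U j w *v u)))\<^sup>2"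
      using mem[OF ls v] mem[OF lu u] f_eq by blast
    also have "\<dots> = f w"
      using unitary_isometry(2)[OF uni] f_eq[OF v u] by (simp add: det2_matrix norm_mult)
    finally show "f (w + axis j 1) = f w" .
  next
    fix w
    obtain v u where v: "v \<in> Rep_cp1 (ls w)" "norm v = 1" and u: "u \<in> Rep_cp1 (lu w)" "norm u = 1"
      using obtain_unit_vector by metis
    then have nz: "v \<noteq> 0" "u \<noteq> 0" by auto
    have "det2 v u \<noteq> 0"
      using ne[of w] cp1_eq_line_through[OF v(1) nz(1)] cp1_eq_line_through[OF u(1) nz(2)]
        line_through_eq_iff[OF nz] by simp
    then show "f w > 0" using f_eq[OF v u] by simp
  qed
  then obtain c where c: "c > 0" "\<And>x. f x \<ge> c" by blast
  have "norm (det2 v u) \<ge> sqrt c"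
    if "v \<in> Rep_cp1 (ls x)" "norm v = 1" "u \<in> Rep_cp1 (lu x)" "norm u = 1" for x v u
    using c(2)[of x] f_eq[OF that] by (simp add: real_le_lsqrt)
  moreover have "sqrt c > 0" using c by simp
  ultimately show ?thesis by blast
qed

text \<open>As \<open>|det U\<^sub>j| = 1\<close>, (K2) makes \<open>|det A|\<close> periodic.\<close>

lemma cocycle_det_bounded_below:
  assumes U: "unitary_sewing_system U" and A: "equivariant_cocycle \<tau> U A"
  shows "\<exists>c>0. \<forall>x. norm (det (A x)) \<ge> c"
proof (rule periodic_bounded_below)
  have "continuous_on UNIV A" using A by (simp add: equivariant_cocycle_def)
  then show "continuous_on UNIV (\<lambda>x. norm (det (A x)))"
    unfolding det_2 by (intro continuous_intros)
  show "norm (det (A w)) > 0" for w using A by (simp add: equivariant_cocycle_def)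
  show "norm (det (A (w + axis j 1))) = norm (det (A w))" for j w
  proof -
    have "A (w + axis j 1) ** U j w = U j (shift \<tau> w) ** A w"
      using A by (simp add: equivariant_cocycle_def)
    then have "norm (det (A (w + axis j 1))) * norm (det (U j w)) = norm (det (U j (shift \<tau> w))) * norm (det (A w))"
      by (metis det_mul norm_mult)
    moreover have "norm (det (U j x)) = 1" for x
      using U unitary_isometry(2) by (simp add: unitary_sewing_system_def)
    ultimately show ?thesis by simp
  qed
qed

lemma equivariance_on_strip:
  assumes A: "bounded_holomorphic_matrix \<delta> K A'" and V: "bounded_holomorphic_matrix \<delta> L V"
    and eq: "\<And>x. A' (complex_vec (x + y)) ** V (complex_vec x) = V (complex_vec (x + \<tau>)) ** A' (complex_vec x)"
    and w: "w \<in> ostrip \<delta>"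
  shows "A' (w + complex_vec y) ** V w = V (w + complex_vec \<tau>) ** A' w"
proof -
  have "(A' (w + complex_vec y) ** V w) $ i $ k - (V (w + complex_vec \<tau>) ** A' w) $ i $ k = 0" for i k
  proof (rule holomorphic2_eq_zero[OF _ _ w,
        of "\<lambda>w. (A' (w + complex_vec y) ** V w) $ i $ k - (V (w + complex_vec \<tau>) ** A' w) $ i $ k"])
    show "holomorphic2_on (\<lambda>w. (A' (w + complex_vec y) ** V w) $ i $ k
        - (V (w + complex_vec \<tau>) ** A' w) $ i $ k) (ostrip \<delta>)"
      by (intro holomorphic2_on_diff
          bounded_holomorphic_matrixD(1)[OF bounded_holomorphic_matrix_mult[OF bounded_holomorphic_matrix_shift[OF A] V]]
          bounded_holomorphic_matrixD(1)[OF bounded_holomorphic_matrix_mult[OF bounded_holomorphic_matrix_shift[OF V] A]])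
    show "(A' (complex_vec x + complex_vec y) ** V (complex_vec x)) $ i $ k
        - (V (complex_vec x + complex_vec \<tau>) ** A' (complex_vec x)) $ i $ k = 0" for x
      using eq[of x] by (simp add: complex_vec_add)
  qed
  then show ?thesis by (simp add: vec_eq_iff)
qed

section \<open>Extension of the stable line field\<close>

theorem theorem6p9:
  fixes \<tau> :: "real^2"
    and U :: "2 \<Rightarrow> real^2 \<Rightarrow> complex^2^2" and A :: "real^2 \<Rightarrow> complex^2^2"
    and \<delta>\<^sub>0 :: real
    and U' :: "2 \<Rightarrow> complex^2 \<Rightarrow> complex^2^2" and A' :: "complex^2 \<Rightarrow> complex^2^2"
    and ls lu :: "real^2 \<Rightarrow> cp1"
  assumes "strip_admissible \<tau> U A \<delta>\<^sub>0 U' A'"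
    and "dominated_splitting \<tau> U A ls lu"
  shows "\<exists>\<delta>>0. \<delta> \<le> \<delta>\<^sub>0 \<and> (\<exists>(N::nat)\<ge>1. \<exists>l :: complex^2 \<Rightarrow> cp1.
    cp1_holomorphic_on l (interior (strip \<delta>)) \<and>
    (\<forall>w\<in>interior (strip \<delta>).
      (\<forall>j. invertible (U' j w) \<and> l (w + axis j 1) = proj_act (U' j w) (l w)) \<and>
      invertible (cocycle_iterate (complex_vec \<tau>) A' N w) \<and>
      proj_act (matrix_inv (cocycle_iterate (complex_vec \<tau>) A' N w))
        (l ((shift (complex_vec \<tau>) ^^ N) w)) = l w) \<and>
    (\<forall>w. l (complex_vec w) = ls w))"
proof -
  have \<delta>0: "\<delta>\<^sub>0 > 0" and U: "unitary_sewing_system U" and A: "equivariant_cocycle \<tau> U A"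
    and extU: "\<And>j. strip_extension \<delta>\<^sub>0 (U j) (U' j)" and extA: "strip_extension \<delta>\<^sub>0 A A'"
    using assms(1) by (auto simp: strip_admissible_def)
  have ls: "invariant_line \<tau> U A ls" and lu: "invariant_line \<tau> U A lu" and ne: "\<And>w. ls w \<noteq> lu w"
    using assms(2) by (auto simp: dominated_splitting_def)
  obtain N \<kappa> where N: "N \<ge> 1" and \<kappa>: "0 < \<kappa>" "\<kappa> < 1"
    and ratio: "\<And>z. norm_on_line (cocycle_iterate \<tau> A N z) (ls z)
            / conorm_on_line (cocycle_iterate \<tau> A N z) (lu z) \<le> \<kappa>\<^sup>2"
    using assms(2) unfolding dominated_splitting_def by blast
  have realU: "U' j (complex_vec x) = U j x" for j x using extU by (simp add: strip_extension_def)
  have realA: "A' (complex_vec x) = A x" for x using extA by (simp add: strip_extension_def)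
  obtain KA where KA: "bounded_holomorphic_matrix \<delta>\<^sub>0 KA A'"
    using strip_extension_bounded_holomorphic[OF extA] by blast
  have "\<forall>j. \<exists>K. bounded_holomorphic_matrix \<delta>\<^sub>0 K (U' j)"
    using strip_extension_bounded_holomorphic[OF extU] by blast
  then obtain KU where KU: "\<And>j. bounded_holomorphic_matrix \<delta>\<^sub>0 (KU j) (U' j)" by metis

  \<comment> \<open>From here on everything concerns the block cocycle \<open>F\<close> over the translation by \<open>\<sigma>\<close>, which
    dominates in a single step.\<close>
  define F where "F = cocycle_iterate (complex_vec \<tau>) A' N"
  define \<sigma> where "\<sigma> = real N *\<^sub>R \<tau>"
  have shiftN: "(shift (complex_vec \<tau>) ^^ N) w = w + complex_vec \<sigma>" for w
    by (simp add: funpow_shift \<sigma>_def complex_vec_scaleR)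
  obtain K where F: "bounded_holomorphic_matrix \<delta>\<^sub>0 K F"
    unfolding F_def using bounded_holomorphic_cocycle_iterate[OF KA] by blast
  have F_real: "F (complex_vec x) = cocycle_iterate \<tau> A N x" for x
    unfolding F_def by (rule cocycle_iterate_complex_vec) (rule realA)
  obtain cA where cA: "cA > 0" "\<And>x. norm (det (A x)) \<ge> cA"
    using cocycle_det_bounded_below[OF U A] by blast
  define c where "c = cA ^ N"
  have c: "c > 0" "norm (det (F (complex_vec x))) \<ge> c" for x
    unfolding c_def F_real using norm_det_cocycle_iterate_ge[of cA A \<tau> x N] cA by simp_all
  have F_det: "det (F (complex_vec x)) \<noteq> 0" for x using c(1) c(2)[of x] by auto

  have inv: "proj_act (F (complex_vec x)) (l x) = l (x + \<sigma>)" if l: "invariant_line \<tau> U A l" for l x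
  proof -
    obtain v where v: "v \<in> Rep_cp1 (l x)" "norm v = 1" using obtain_unit_vector .
    then have v0: "v \<noteq> 0" by auto
    have "F (complex_vec x) *v v \<in> Rep_cp1 (l (x + \<sigma>)) - {0}"
      unfolding F_def \<sigma>_def
    proof (rule mem_line_funpow[where l = l, OF _ _ v(1) v0])
      show "proj_act (A' (complex_vec x)) (l x) = l (x + \<tau>)" for x
        using l by (simp add: realA invariant_line_def shift_def)
      show "det (A' (complex_vec x)) \<noteq> 0" for x
        using A by (simp add: realA equivariant_cocycle_def)
    qed
    then show ?thesis
      using cp1_eq_line_through[OF v(1) v0] proj_act_line_through[OF v0] cp1_eq_line_through by auto
  qed
  obtain d where d: "d > 0" "\<And>x v u. v \<in> Rep_cp1 (ls x) \<Longrightarrow> norm v = 1 \<Longrightarrow> u \<in> Rep_cp1 (lu x) \<Longrightarrow> norm u = 1 \<Longrightarrow>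
      norm (det2 v u) \<ge> d"
    using dominated_splitting_angle[OF U ls lu ne] by blast
  have dom: "norm (F (complex_vec x) *v v) * norm u \<le> \<kappa>\<^sup>2 * (norm (F (complex_vec x) *v u) * norm v)"
    if v: "v \<in> Rep_cp1 (ls x)" and u: "u \<in> Rep_cp1 (lu x)" for x v u
  proof (cases "v = 0 \<or> u = 0")
    case False
    then have nz: "v \<noteq> 0" "u \<noteq> 0" by auto
    have Fu: "F (complex_vec x) *v u \<noteq> 0" using matrix_vector_nonzero[OF F_det nz(2)] .
    have "(norm (F (complex_vec x) *v v) / norm v) / (norm (F (complex_vec x) *v u) / norm u) \<le> \<kappa>\<^sup>2"
      using ratio[of x] norm_on_line_eq[OF v nz(1)] norm_on_line_eq[OF u nz(2)] by (simp add: F_real)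
    then show ?thesis using nz Fu by (simp add: divide_simps mult_ac)
  qed auto
  have \<kappa>2: "0 \<le> \<kappa>\<^sup>2" "\<kappa>\<^sup>2 < 1" using \<kappa> by (auto simp: power_less_one_iff)

  have "\<exists>\<rho>>0. \<forall>x. \<exists>v. (\<forall>i. holomorphic2_on (\<lambda>w. v w $ i) (ball (complex_vec x) \<rho>)) \<and>
    (\<forall>w\<in>ball (complex_vec x) \<rho>. dominated_direction (\<lambda>n. cocycle_iterate (complex_vec \<sigma>) F n w) (v w))"
    by (rule holomorphic_dominated_direction_near_real[OF F \<delta>0 c inv[OF ls] inv[OF lu] d(1) _ _ \<kappa>2])
      (erule (3) d(2), erule (1) dom)
  then obtain \<rho> where \<rho>: "\<rho> > 0" and loc: "\<And>x. \<exists>v. (\<forall>i. holomorphic2_on (\<lambda>w. v w $ i) (ball (complex_vec x) \<rho>)) \<and>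
    (\<forall>w\<in>ball (complex_vec x) \<rho>. dominated_direction (\<lambda>n. cocycle_iterate (complex_vec \<sigma>) F n w) (v w))"
    by blast
  obtain \<delta>F where \<delta>F: "\<delta>F > 0" "\<delta>F < \<delta>\<^sub>0" "\<And>w. w \<in> ostrip \<delta>F \<Longrightarrow> norm (det (F w)) \<ge> c / 2"
    using det_bounded_below_near_real[OF F \<delta>0 c] by blast
  have "\<exists>\<delta>'>0. \<delta>' < \<delta>\<^sub>0 \<and> (\<forall>w\<in>ostrip \<delta>'. norm (det (U' j w)) \<ge> 1 / 2)" for j
  proof (rule det_bounded_below_near_real[OF KU \<delta>0])
    show "1 \<le> norm (det (U' j (complex_vec x)))" for x
      unfolding realU using U unitary_isometry(2) by (simp add: unitary_sewing_system_def)
  qed simp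
  then obtain \<delta>U where \<delta>U: "\<And>j. \<delta>U j > 0" "\<And>j w. w \<in> ostrip (\<delta>U j) \<Longrightarrow> norm (det (U' j w)) \<ge> 1 / 2"
    by metis
  \<comment> \<open>On this strip the block and the sewing maps are invertible, and every point is within \<open>\<rho>\<close> of its
    real part.\<close>
  define \<delta>1 where "\<delta>1 = min (min \<delta>F (\<rho> / 2)) (min (\<delta>U 1) (\<delta>U 2))"
  have \<delta>1: "\<delta>1 > 0" using \<delta>F \<rho> \<delta>U by (simp add: \<delta>1_def)
  have "\<delta>1 \<le> \<delta>U j" for j using exhaust_2[of j] by (auto simp: \<delta>1_def)
  moreover have "\<delta>1 \<le> \<delta>F" "\<delta>1 \<le> \<rho> / 2" by (auto simp: \<delta>1_def)
  ultimately have le: "\<And>j. \<delta>1 \<le> \<delta>U j" "\<delta>1 \<le> \<delta>F" "\<delta>1 \<le> \<rho> / 2" "\<delta>1 \<le> \<delta>\<^sub>0" using \<delta>F(2) by auto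
  define \<delta> where "\<delta> = \<delta>1 / 2"
  define S where "S = interior (strip \<delta>)"
  have S_sub: "S \<subseteq> ostrip \<delta>1"
    using strip_subset_ostrip[of \<delta> \<delta>1] interior_subset[of "strip \<delta>"] \<delta>1 by (auto simp: S_def \<delta>_def)
  define M where "M w n = cocycle_iterate (complex_vec \<sigma>) F n w" for w n
  define l where "l w = slow_line (M w)" for w
  have F_nz: "det (F w) \<noteq> 0" if "w \<in> ostrip \<delta>1" for w
    using \<delta>F(3)[of w] ostrip_mono[OF le(2)] that c(1) by auto
  have M_nz: "det (M w n) \<noteq> 0" if w: "w \<in> ostrip \<delta>1" for w n
    unfolding M_def
  proof (rule det_cocycle_iterate_nonzero)
    have "(shift (complex_vec \<sigma>) ^^ k) w = w + complex_vec (real k *\<^sub>R \<sigma>)" for k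
      by (simp add: funpow_shift complex_vec_scaleR)
    then show "det (F ((shift (complex_vec \<sigma>) ^^ k) w)) \<noteq> 0" for k
      using F_nz ostrip_real_shift[OF w] by simp
  qed
  have near: "\<exists>x. w \<in> ball (complex_vec x) \<rho>" if w: "w \<in> ostrip \<delta>1" for w
    using norm_diff_complex_vec_Re[OF w] le(3)
    by (intro exI[of _ "\<chi> i. Re (w $ i)"]) (simp add: dist_norm norm_minus_commute)
  have dominated: "\<exists>v. dominated_direction (M w) v \<and> l w = line_through v" if w: "w \<in> ostrip \<delta>1" for w
    using near[OF w] loc slow_line_eq[OF M_nz[OF w]] unfolding M_def l_def by meson
  have l_eqI: "l w = line_through v" if "w \<in> ostrip \<delta>1" "dominated_direction (M w) v" for w v
    unfolding l_def by (rule slow_line_eq[OF M_nz[OF that(1)] that(2)])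

  have l_real: "l (complex_vec x) = ls x" for x
  proof -
    obtain v where v: "v \<in> Rep_cp1 (ls x)" "norm v = 1" using obtain_unit_vector .
    then have v0: "v \<noteq> 0" by auto
    have "dominated_direction (M (complex_vec x)) v"
      unfolding M_def
      by (rule dominated_direction_real[OF inv[OF ls] inv[OF lu] F_det _ \<kappa>2 v(1) v0]) (erule (1) dom)
    then show ?thesis
      using l_eqI[OF complex_vec_in_ostrip[OF \<delta>1]] cp1_eq_line_through[OF v(1) v0] by simp
  qed

  have l_sew: "l (w + axis j 1) = proj_act (U' j w) (l w)" and U_nz: "det (U' j w) \<noteq> 0"
    if w: "w \<in> ostrip \<delta>1" for w j
  proof -
    have in_strips: "z \<in> ostrip \<delta>\<^sub>0" "norm (det (U' j z)) \<ge> 1 / 2" if "z \<in> ostrip \<delta>1" for z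
      using that ostrip_mono[OF le(4)] ostrip_mono[OF le(1)] \<delta>U(2) by blast+
    have det0: "det (U' j z) \<noteq> 0" if "z \<in> ostrip \<delta>1" for z using in_strips(2)[OF that] by auto
    then show "det (U' j w) \<noteq> 0" using w .
    have KUpos: "KU j > 0" using bounded_holomorphic_matrix_pos[OF KU in_strips(1) det0] w by blast
    have "A' (z + complex_vec (axis j 1)) ** U' j z = U' j (z + complex_vec \<tau>) ** A' z" if "z \<in> ostrip \<delta>\<^sub>0" for z
    proof (rule equivariance_on_strip[OF KA KU _ that])
      show "A' (complex_vec (x + axis j 1)) ** U' j (complex_vec x) = U' j (complex_vec (x + \<tau>)) ** A' (complex_vec x)" for x
        using A by (simp add: realA realU equivariant_cocycle_def shift_def)
    qed
    then have "F (z + axis j 1) ** U' j z = U' j (z + complex_vec \<sigma>) ** F z" if "z \<in> ostrip \<delta>\<^sub>0" for z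
      using cocycle_iterate_equivariant[of "ostrip \<delta>\<^sub>0" "complex_vec \<tau>" A' "axis j 1" "U' j" z N] that ostrip_real_shift
      by (simp add: F_def \<sigma>_def complex_vec_axis complex_vec_scaleR)
    then have eq: "M (w + axis j 1) n ** U' j w = U' j (w + complex_vec (real n *\<^sub>R \<sigma>)) ** M w n" for n
      using cocycle_iterate_equivariant[of "ostrip \<delta>\<^sub>0" "complex_vec \<sigma>" F "axis j 1" "U' j" w n] in_strips(1)[OF w] ostrip_real_shift
      by (simp add: M_def complex_vec_scaleR)
    obtain v where v: "dominated_direction (M w) v" "l w = line_through v" using dominated[OF w] by blast
    have "dominated_direction (M (w + axis j 1)) (U' j w *v v)"
    proof (rule dominated_direction_transfer[OF det0[OF w] _ _ _ M_nz[OF w] v(1)])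
      show "1 / (8 * KU j) > 0" using KUpos by simp
      fix n x
      define z where "z = w + complex_vec (real n *\<^sub>R \<sigma>)"
      have z: "z \<in> ostrip \<delta>1" unfolding z_def by (rule ostrip_real_shift[OF w])
      have Mz: "M (w + axis j 1) n *v (U' j w *v x) = U' j z *v (M w n *v x)"
        using eq[of n] by (simp add: matrix_vector_mul_assoc z_def)
      have K: "norm (U' j z $ i $ k) \<le> KU j" for i k
        using bounded_holomorphic_matrixD(2)[OF KU in_strips(1)[OF z]] .
      show "norm (M (w + axis j 1) n *v (U' j w *v x)) \<le> 4 * KU j * norm (M w n *v x)"
        unfolding Mz by (rule norm_matrix_vector_le[OF K])
      have "1 / 2 * norm (M w n *v x) \<le> norm (det (U' j z)) * norm (M w n *v x)"
        using in_strips(2)[OF z] by (intro mult_right_mono) auto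
      also have "\<dots> \<le> 4 * KU j * norm (U' j z *v (M w n *v x))"
        by (rule norm_matrix_vector_ge[OF K])
      finally show "1 / (8 * KU j) * norm (M w n *v x) \<le> norm (M (w + axis j 1) n *v (U' j w *v x))"
        unfolding Mz using KUpos by (simp add: pos_divide_le_eq mult_ac)
    qed
    moreover have "w + axis j 1 \<in> ostrip \<delta>1"
      using ostrip_real_shift[OF w, of "axis j 1"] by (simp add: complex_vec_axis)
    ultimately have "l (w + axis j 1) = line_through (U' j w *v v)" using l_eqI by blast
    then show "l (w + axis j 1) = proj_act (U' j w) (l w)"
      using v proj_act_line_through by (simp add: dominated_direction_def)
  qed

  have l_inv: "proj_act (matrix_inv (F w)) (l (w + complex_vec \<sigma>)) = l w" if w: "w \<in> ostrip \<delta>1" for w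
  proof -
    obtain v where v: "dominated_direction (M w) v" "l w = line_through v" using dominated[OF w] by blast
    have Msuc: "M (w + complex_vec \<sigma>) n *v (F w *v x) = M w (Suc n) *v x" for n x
      unfolding M_def cocycle_iterate_Suc_right by (simp add: matrix_vector_mul_assoc)
    have "dominated_direction (\<lambda>n. M w (Suc n)) v"
      using v(1) LIMSEQ_Suc unfolding dominated_direction_def by blast
    \<comment> \<open>The orbit of \<open>w + \<sigma>\<close> is the tail of the orbit of \<open>w\<close>.\<close>
    then have "dominated_direction (M (w + complex_vec \<sigma>)) (F w *v v)"
      by (rule dominated_direction_transfer[OF F_nz[OF w], where c = 1 and K = 1, rotated -1])
        (auto simp: Msuc M_nz[OF w])
    then have "l (w + complex_vec \<sigma>) = line_through (F w *v v)"
      using l_eqI ostrip_real_shift[OF w] by blast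
    moreover have "v \<noteq> 0" using v(1) by (simp add: dominated_direction_def)
    moreover have "matrix_inv (F w) *v (F w *v v) = v"
      using matrix_inv_left[of "F w"] F_nz[OF w] by (simp add: matrix_vector_mul_assoc invertible_det_nz)
    ultimately show ?thesis
      using proj_act_line_through matrix_vector_nonzero[OF F_nz[OF w]] v(2) by simp
  qed

  have "cp1_holomorphic_on l S"
  proof (rule cp1_holomorphic_on_line_through)
    show "open S" by (simp add: S_def)
    fix w assume "w \<in> S"
    then obtain x where x: "w \<in> ball (complex_vec x) \<rho>" using near S_sub by blast
    obtain v where v: "\<forall>i. holomorphic2_on (\<lambda>w. v w $ i) (ball (complex_vec x) \<rho>)"
      "\<And>z. z \<in> ball (complex_vec x) \<rho> \<Longrightarrow> dominated_direction (M z) (v z)"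
      using loc[of x] unfolding M_def by blast
    have "v z \<noteq> 0 \<and> l z = line_through (v z)" if "z \<in> S \<inter> ball (complex_vec x) \<rho>" for z
      using that S_sub v(2)[of z] l_eqI[of z] by (auto simp: dominated_direction_def)
    then show "\<exists>T v. open T \<and> w \<in> T \<and> (\<forall>i. holomorphic2_on (\<lambda>w. v w $ i) T) \<and>
      (\<forall>w\<in>S \<inter> T. v w \<noteq> 0 \<and> l w = line_through (v w))"
      using x v(1) open_ball by blast
  qed
  moreover have "(\<forall>j. invertible (U' j w) \<and> l (w + axis j 1) = proj_act (U' j w) (l w)) \<and>
      invertible (cocycle_iterate (complex_vec \<tau>) A' N w) \<and>
      proj_act (matrix_inv (cocycle_iterate (complex_vec \<tau>) A' N w))
        (l ((shift (complex_vec \<tau>) ^^ N) w)) = l w" if "w \<in> S" for w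
  proof -
    have w: "w \<in> ostrip \<delta>1" using that S_sub by blast
    show ?thesis
      using l_sew[OF w] U_nz[OF w] l_inv[OF w] F_nz[OF w]
      unfolding shiftN F_def invertible_det_nz by simp
  qed
  moreover have "\<delta> > 0" "\<delta> \<le> \<delta>\<^sub>0" using \<delta>1 le(4) by (auto simp: \<delta>_def)
  ultimately show ?thesis
    using N l_real unfolding S_def by blast
qed

end
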